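(* For any small category $\mathcal{C}$ and any endofunctor $F:\mathcal{C}\to\mathcal{C}$, the simplicial set $N^F\mathcal{C}$ (the $F$-twisted cyclic nerve of $\mathcal{C}$) is $2$-Segal.
   Context: $N^F_n\mathcal{C}$ is the set of chains of morphisms in $\mathcal{C}$ of the form $$\Sigma=\{x_0\xrightarrow{u_{01}}x_1\xrightarrow{u_{12}}x_2\to\cdots\xrightarrow{u_{n-1,n}}x_n\xrightarrow{u_{n0}}F(x_0)\}.$$ For $1\le i\le n$, $\partial_i(\Sigma)$ is obtained by omitting $x_i$ and composing the two arrows going in and out of it; $\partial_0(\Sigma)=\{x_1\xrightarrow{u_{12}}x_2\to\cdots\to x_n\xrightarrow{F(u_{01})\circ u_{n0}}F(x_1)\}$. For $0\le i\le n$, $s_i(\Sigma)$ is obtained by replacing $x_i$ by $x_i\xrightarrow{\mathrm{Id}}x_i$. A simplicial set $Y$ is $2$-Segal if for every $n\ge2$ and every triangulation $\mathcal{T}$ of a convex $(n+1)$-gon $P_n$ with vertices labelled $0,\dots,n$ counterclockwise (triangles having vertices among those of $P_n$), the restriction map $Y_n=\mathrm{Hom}(\Delta^n,Y)\to Y_{\mathcal{T}}:=\mathrm{Hom}(\Delta^{\mathcal{T}},Y)$ is a bijection of sets. Here $\Delta^{\mathcal{T}}=\bigcup_J\Delta^J\subset\Delta^n$, the union over the vertex sets $J\subset[n]$ of triangles of $\mathcal{T}$. *)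

theory Defs
  imports "HOL-Analysis.Analysis"
begin

record ('o, 'm) cat =
  Obj :: "'o set"
  Arr :: "'m set"
  Dom :: "'m \<Rightarrow> 'o"
  Cod :: "'m \<Rightarrow> 'o"
  Id :: "'o \<Rightarrow> 'm"
  Comp :: "'m \<Rightarrow> 'm \<Rightarrow> 'm"  (* Comp C g f is "g after f" *)

locale category =
  fixes C :: "('o, 'm) cat"
  assumes Dom_in: "f \<in> Arr C \<Longrightarrow> Dom C f \<in> Obj C"
    and Cod_in: "f \<in> Arr C \<Longrightarrow> Cod C f \<in> Obj C"
    and Id_in: "x \<in> Obj C \<Longrightarrow> Id C x \<in> Arr C"
    and Dom_Id: "x \<in> Obj C \<Longrightarrow> Dom C (Id C x) = x"
    and Cod_Id: "x \<in> Obj C \<Longrightarrow> Cod C (Id C x) = x"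
    and Comp_in: "\<lbrakk>f \<in> Arr C; g \<in> Arr C; Cod C f = Dom C g\<rbrakk> \<Longrightarrow> Comp C g f \<in> Arr C"
    and Dom_Comp: "\<lbrakk>f \<in> Arr C; g \<in> Arr C; Cod C f = Dom C g\<rbrakk> \<Longrightarrow> Dom C (Comp C g f) = Dom C f"
    and Cod_Comp: "\<lbrakk>f \<in> Arr C; g \<in> Arr C; Cod C f = Dom C g\<rbrakk> \<Longrightarrow> Cod C (Comp C g f) = Cod C g"
    and Comp_Id_right: "f \<in> Arr C \<Longrightarrow> Comp C f (Id C (Dom C f)) = f"
    and Comp_Id_left: "f \<in> Arr C \<Longrightarrow> Comp C (Id C (Cod C f)) f = f"
    and Comp_assoc: "\<lbrakk>f \<in> Arr C; g \<in> Arr C; h \<in> Arr C; Cod C f = Dom C g; Cod C g = Dom C h\<rbrakk>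
      \<Longrightarrow> Comp C h (Comp C g f) = Comp C (Comp C h g) f"

record ('o, 'm) endo =
  obj_map :: "'o \<Rightarrow> 'o"
  arr_map :: "'m \<Rightarrow> 'm"

locale endofunctor = category C
  for C :: "('o, 'm) cat" +
  fixes F :: "('o, 'm) endo"
  assumes obj_map_in: "x \<in> Obj C \<Longrightarrow> obj_map F x \<in> Obj C"
    and arr_map_in: "f \<in> Arr C \<Longrightarrow> arr_map F f \<in> Arr C"
    and Dom_arr_map: "f \<in> Arr C \<Longrightarrow> Dom C (arr_map F f) = obj_map F (Dom C f)"
    and Cod_arr_map: "f \<in> Arr C \<Longrightarrow> Cod C (arr_map F f) = obj_map F (Cod C f)"
    and arr_map_Id: "x \<in> Obj C \<Longrightarrow> arr_map F (Id C x) = Id C (obj_map F x)"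
    and arr_map_Comp: "\<lbrakk>f \<in> Arr C; g \<in> Arr C; Cod C f = Dom C g\<rbrakk>
      \<Longrightarrow> arr_map F (Comp C g f) = Comp C (arr_map F g) (arr_map F f)"

text \<open>\<open>face Y n i\<close> is the map $\partial_i : Y_n \to Y_{n-1}$ (relevant for $n \ge 1$, $i \le n$) and
  \<open>degen Y n i\<close> is the map $s_i : Y_n \to Y_{n+1}$ (relevant for $i \le n$); the values outside
  these ranges are junk.\<close>

record 'a sset =
  simplices :: "nat \<Rightarrow> 'a set"
  face :: "nat \<Rightarrow> nat \<Rightarrow> 'a \<Rightarrow> 'a"
  degen :: "nat \<Rightarrow> nat \<Rightarrow> 'a \<Rightarrow> 'a"

locale simplicial_set =
  fixes Y :: "'a sset"
  assumes face_in: "\<lbrakk>y \<in> simplices Y (Suc n); i \<le> Suc n\<rbrakk> \<Longrightarrow> face Y (Suc n) i y \<in> simplices Y n"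
    and degen_in: "\<lbrakk>y \<in> simplices Y n; i \<le> n\<rbrakk> \<Longrightarrow> degen Y n i y \<in> simplices Y (Suc n)"
    and face_face: "\<lbrakk>y \<in> simplices Y (Suc (Suc n)); i < j; j \<le> Suc (Suc n)\<rbrakk>
      \<Longrightarrow> face Y (Suc n) i (face Y (Suc (Suc n)) j y)
        = face Y (Suc n) (j - 1) (face Y (Suc (Suc n)) i y)"
    and degen_degen: "\<lbrakk>y \<in> simplices Y n; i \<le> j; j \<le> n\<rbrakk>
      \<Longrightarrow> degen Y (Suc n) i (degen Y n j y) = degen Y (Suc n) (Suc j) (degen Y n i y)"
    and face_degen_less: "\<lbrakk>y \<in> simplices Y (Suc n); i < j; j \<le> Suc n\<rbrakk>
      \<Longrightarrow> face Y (Suc (Suc n)) i (degen Y (Suc n) j y) = degen Y n (j - 1) (face Y (Suc n) i y)"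
    and face_degen_same: "\<lbrakk>y \<in> simplices Y n; j \<le> n; i = j \<or> i = Suc j\<rbrakk>
      \<Longrightarrow> face Y (Suc n) i (degen Y n j y) = y"
    and face_degen_greater: "\<lbrakk>y \<in> simplices Y (Suc n); Suc j < i; i \<le> Suc (Suc n)\<rbrakk>
      \<Longrightarrow> face Y (Suc (Suc n)) i (degen Y (Suc n) j y) = degen Y n j (face Y (Suc n) (i - 1) y)"

text \<open>Simplicial maps are taken to be extensional in each degree, so that equality of maps is
  equality in HOL.\<close>

definition sset_hom :: "'a sset \<Rightarrow> 'b sset \<Rightarrow> (nat \<Rightarrow> 'a \<Rightarrow> 'b) set" where
  "sset_hom X Y = {g.
     (\<forall>k. g k \<in> simplices X k \<rightarrow>\<^sub>E simplices Y k) \<and>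
     (\<forall>k i. \<forall>x \<in> simplices X (Suc k). i \<le> Suc k \<longrightarrow>
        g k (face X (Suc k) i x) = face Y (Suc k) i (g (Suc k) x)) \<and>
     (\<forall>k i. \<forall>x \<in> simplices X k. i \<le> k \<longrightarrow>
        g (Suc k) (degen X k i x) = degen Y k i (g k x))}"

text \<open>A $k$-simplex of $\Delta^n$, i.e. a monotone map $\sigma : [k] \to [n]$, is the weakly
  increasing list $\sigma(0), \dots, \sigma(k)$; for $J \subseteq [n]$ the simplices of $\Delta^J$
  are those whose image lies in $J$. For a set \<open>T\<close> of subsets of $[n]$, \<open>simplex_union T\<close> is
  $\bigcup_{J \in T} \Delta^J \subseteq \Delta^n$.\<close>

definition simplex_union :: "nat set set \<Rightarrow> nat list sset" where
  "simplex_union T = \<lparr>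
     simplices = (\<lambda>k. \<Union>J\<in>T. {\<sigma>. length \<sigma> = Suc k \<and> sorted \<sigma> \<and> set \<sigma> \<subseteq> J}),
     face = (\<lambda>k i \<sigma>. take i \<sigma> @ drop (Suc i) \<sigma>),
     degen = (\<lambda>k i \<sigma>. take (Suc i) \<sigma> @ drop i \<sigma>)\<rparr>"

definition std_simplex :: "nat \<Rightarrow> nat list sset" where
  "std_simplex n = simplex_union {{..n}}"

text \<open>The identification $Y_n = \mathrm{Hom}(\Delta^n, Y)$: an $n$-simplex \<open>y\<close> corresponds to the
  unique simplicial map taking the identity of $[n]$ to \<open>y\<close>.\<close>

definition classifying_map :: "'a sset \<Rightarrow> nat \<Rightarrow> 'a \<Rightarrow> nat \<Rightarrow> nat list \<Rightarrow> 'a" where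
  "classifying_map Y n y = (THE g. g \<in> sset_hom (std_simplex n) Y \<and> g n [0..<Suc n] = y)"

definition restrict_hom :: "'a sset \<Rightarrow> (nat \<Rightarrow> 'a \<Rightarrow> 'b) \<Rightarrow> nat \<Rightarrow> 'a \<Rightarrow> 'b" where
  "restrict_hom X g = (\<lambda>k. restrict (g k) (simplices X k))"

text \<open>Twice the signed area of the triangle $abc$: positive iff $a, b, c$ are in strictly
  counterclockwise order.\<close>

definition orient :: "real^2 \<Rightarrow> real^2 \<Rightarrow> real^2 \<Rightarrow> real" where
  "orient a b c = (b$1 - a$1) * (c$2 - a$2) - (b$2 - a$2) * (c$1 - a$1)"

text \<open>The points $p_0, \dots, p_n$ are the vertices, in counterclockwise order, of a (strictly)
  convex polygon. The polygon itself is their convex hull.\<close>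

definition convex_polygon :: "nat \<Rightarrow> (nat \<Rightarrow> real^2) \<Rightarrow> bool" where
  "convex_polygon n p \<longleftrightarrow> (\<forall>i j k. i < j \<and> j < k \<and> k \<le> n \<longrightarrow> orient (p i) (p j) (p k) > 0)"

text \<open>A triangulation is recorded by the vertex sets \<open>J\<close> of its triangles. The library predicate
  \<open>triangulation\<close> requires finiteness and that any two triangles meet in a common (possibly
  empty) face; it does not mention the region being covered.\<close>

definition polygon_triangulation :: "nat \<Rightarrow> (nat \<Rightarrow> real^2) \<Rightarrow> nat set set \<Rightarrow> bool" where
  "polygon_triangulation n p T \<longleftrightarrow>
     (\<forall>J\<in>T. J \<subseteq> {..n} \<and> card J = 3) \<and>
     triangulation ((\<lambda>J. convex hull (p ` J)) ` T) \<and>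
     (\<Union>J\<in>T. convex hull (p ` J)) = convex hull (p ` {..n})"

definition two_segal :: "'a sset \<Rightarrow> bool" where
  "two_segal Y \<longleftrightarrow> simplicial_set Y \<and>
     (\<forall>n p T. 2 \<le> n \<and> convex_polygon n p \<and> polygon_triangulation n p T \<longrightarrow>
        bij_betw (\<lambda>y. restrict_hom (simplex_union T) (classifying_map Y n y))
          (simplices Y n) (sset_hom (simplex_union T) Y))"

text \<open>The chain $x_0 \to x_1 \to \dots \to x_n \to F(x_0)$ is the list
  $[u_{01}, \dots, u_{n-1,n}, u_{n0}]$ of its $n+1$ arrows; the objects are recovered as
  \<open>x\<^sub>i = Dom C (us ! i)\<close>. Thus \<open>us ! (i - 1)\<close> is the arrow into $x_i$ (for $i \ge 1$) and
  \<open>us ! i\<close> is the arrow out of it.\<close>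

definition twisted_nerve :: "('o, 'm) cat \<Rightarrow> ('o, 'm) endo \<Rightarrow> 'm list sset" where
  "twisted_nerve C F = \<lparr>
     simplices = (\<lambda>n. {us. length us = Suc n \<and> set us \<subseteq> Arr C \<and>
        (\<forall>i<n. Cod C (us ! i) = Dom C (us ! Suc i)) \<and>
        Cod C (us ! n) = obj_map F (Dom C (us ! 0))}),
     face = (\<lambda>n i us.
        if i = 0 then butlast (tl us) @ [Comp C (arr_map F (hd us)) (last us)]
        else take (i - 1) us @ [Comp C (us ! i) (us ! (i - 1))] @ drop (Suc i) us),
     degen = (\<lambda>n i us. take i us @ [Id C (Dom C (us ! i))] @ drop i us)\<rparr>"

end

theory Submission
  imports Defs
begin

text \<open>A simplicial map from $\Delta^T$ to $N^F\mathcal{C}$ is determined by its values on edges: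
  the edge $a \le b$ is sent to a chain $u_{ab} : x_a \to x_b$, $u_{ba} : x_b \to F(x_a)$, and the
  triangle $a \le b \le c$ imposes $u_{bc} u_{ab} = u_{ac}$, $u_{ca} u_{bc} = u_{ba}$ and
  $F(u_{ab}) u_{ca} = u_{cb}$. An $n$-simplex of $N^F\mathcal{C}$ is exactly an assignment of
  arrows $u_{i,i+1}$ and $u_{n0}$ to the sides of the polygon. Given a triangulation, the relations
  determine $u_{ab}$ for $a < b$ from the sides by induction on $b - a$, through the triangle on the
  edge $ab$ whose third vertex lies between $a$ and $b$, and $u_{ba}$ by induction on
  $n - (b - a)$, through the triangle on the other side of the edge. So all that is needed of the
  triangulation is the existence of a triangle on each side of each edge.\<close>

subsection \<open>Triangles along an edge\<close>

text \<open>Existence and uniqueness are kept apart. A chain extends to all edges of [n] by closed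
  formulas, without reference to a triangulation: u_{ab} is a composite of consecutive sides, and
  u_{ba} runs from x_b to x_n, along u_{n0}, and on by F(u_{0a}). The inductions through triangles
  then only show that edge data is determined by its sides, so different orders of filling never
  have to be compared. The condition \<open>fillable\<close> also holds for {[n]}. One bijection
  therefore serves twice: it evaluates the definite description in \<open>classifying_map\<close>,
  and it treats the triangulation itself. Iterated faces of chains are awkward to compute, because
  face 0 applies F to the first arrow and moves it to the end. The simplicial identities are instead
  carried over from the standard simplex, where they are identities between index maps.\<close>

lemma orient_simps [simp]: "orient a b a = 0" "orient a b b = 0" "orient a a b = 0"
  by (simp_all add: orient_def algebra_simps)

lemma orient_rotate: "orient b c a = orient a b c"
  by (simp add: orient_def algebra_simps)

lemma orient_swap: "orient b a c = - orient a b c"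
  by (simp add: orient_def algebra_simps)

text \<open>Signed area is affine in its third argument. Half-planes and lines are hence convex, and
  a convex hull can be confined to one by looking at its vertices.\<close>

lemma orient_convex:
  assumes "u + v = 1"
  shows "orient a b (u *\<^sub>R c + v *\<^sub>R d) = u * orient a b c + v * orient a b d"
proof -
  from assms have "u = 1 - v" by simp
  then show ?thesis
    unfolding orient_def \<open>u = 1 - v\<close> by (simp add: algebra_simps)
qed

lemma convex_orient_nonneg: "convex {c. 0 \<le> orient a b c}"
  by (rule convexI) (auto simp: orient_convex)

lemma convex_orient_pos: "convex {c. 0 < orient a b c}"
proof (rule convexI)
  fix c d and u v :: real
  assume *: "c \<in> {c. 0 < orient a b c}" "d \<in> {c. 0 < orient a b c}" "0 \<le> u" "0 \<le> v" "u + v = 1"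
  then show "u *\<^sub>R c + v *\<^sub>R d \<in> {c. 0 < orient a b c}"
    by (cases "u = 0")
       (auto simp: orient_convex intro: add_pos_nonneg add_nonneg_pos)
qed

lemma convex_orient_zero: "convex {c. orient a b c = 0}"
  by (rule convexI) (auto simp: orient_convex)

section \<open>Vertices and triangles of a convex polygon\<close>

context
  fixes n :: nat and p :: "nat \<Rightarrow> real^2"
  assumes poly: "convex_polygon n p"
begin

text \<open>Rotating the three points brings the labels into increasing order, where
  \<open>convex_polygon\<close> applies; exchanging the first two flips the sign. For k = i or k = j
  the area is 0 and both sides are false.\<close>

lemma orient_polygon_pos_iff:
  assumes "i < j" "j \<le> n" "k \<le> n"
  shows "0 < orient (p i) (p j) (p k) \<longleftrightarrow> k < i \<or> j < k"
    and "0 < orient (p j) (p i) (p k) \<longleftrightarrow> i < k \<and> k < j"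
proof -
  have ord: "0 < orient (p a) (p b) (p c)" if "a < b" "b < c" "c \<le> n" for a b c
    using poly that unfolding convex_polygon_def by blast
  consider "k < i" | "k = i" | "i < k" "k < j" | "k = j" | "j < k" by linarith
  then have "(0 < orient (p i) (p j) (p k) \<longleftrightarrow> k < i \<or> j < k) \<and>
    (0 < orient (p j) (p i) (p k) \<longleftrightarrow> i < k \<and> k < j)"
  proof cases
    case 1
    then have "0 < orient (p i) (p j) (p k)"
      using ord[of k i j] assms orient_rotate[of "p i" "p j" "p k"] by simp
    then show ?thesis using 1 assms orient_swap[of "p j" "p i"] by auto
  next
    case 3
    then have "0 < orient (p j) (p i) (p k)"
      using ord[of i k j] assms orient_rotate[of "p j" "p i" "p k"] orient_rotate[of "p k" "p j" "p i"]
      by simp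
    then show ?thesis using 3 assms orient_swap[of "p i" "p j"] by auto
  next
    case 5
    then have "0 < orient (p i) (p j) (p k)"
      using ord[of i j k] assms by simp
    then show ?thesis using 5 assms orient_swap[of "p j" "p i"] by auto
  qed (use assms in auto)
  then show "0 < orient (p i) (p j) (p k) \<longleftrightarrow> k < i \<or> j < k"
    and "0 < orient (p j) (p i) (p k) \<longleftrightarrow> i < k \<and> k < j" by auto
qed

lemma orient_polygon_nonzero:
  assumes "i \<le> n" "j \<le> n" "k \<le> n" "i \<noteq> j" "i \<noteq> k" "j \<noteq> k"
  shows "orient (p i) (p j) (p k) \<noteq> 0"
proof (cases "i < j")
  case True
  then show ?thesis
    using orient_polygon_pos_iff[of i j k] assms orient_swap[of "p i" "p j" "p k"] by linarith
next
  case False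
  then show ?thesis
    using orient_polygon_pos_iff[of j i k] assms orient_swap[of "p i" "p j" "p k"] by linarith
qed

lemma polygon_inj_on:
  assumes "2 \<le> n"
  shows "inj_on p {..n}"
proof (rule inj_onI)
  fix i j assume ij: "i \<in> {..n}" "j \<in> {..n}" "p i = p j"
  \<comment> \<open>A vertex apart from i and j turns p i = p j into a triangle of area 0 on
    distinct labels.\<close>
  have "\<exists>k\<in>{0, 1, 2}. k \<noteq> i \<and> k \<noteq> j" by auto
  then obtain k where k: "k \<in> {0, 1, 2}" "k \<noteq> i" "k \<noteq> j" by blast
  then have "k \<le> n" using assms by auto
  with k show "i = j"
    using orient_polygon_nonzero[of i j k] ij by auto
qed

text \<open>The opposite edge lies on a line that misses p i. Extremality is what lets a vertex of
  one triangle be recognised as a vertex of another through their common face.\<close>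

lemma polygon_triangle_extreme_point:
  assumes J: "J \<subseteq> {..n}" "card J = 3" and "i \<in> J"
  shows "p i extreme_point_of (convex hull (p ` J))"
proof -
  have "finite J" using J(2) card.infinite by fastforce
  then have "card (J - {i}) = 2" using J(2) \<open>i \<in> J\<close> by simp
  then obtain j k where jk: "J - {i} = {j, k}" "j \<noteq> k" by (auto simp: card_2_iff)
  then have mem: "i \<le> n" "j \<le> n" "k \<le> n" "i \<noteq> j" "i \<noteq> k" using J(1) \<open>i \<in> J\<close> by auto
  have "convex hull {p j, p k} \<subseteq> {c. orient (p j) (p k) c = 0}"
    by (intro hull_minimal convex_orient_zero) simp
  moreover have "orient (p j) (p k) (p i) \<noteq> 0"
    using orient_polygon_nonzero[of j k i] mem jk(2) by metis
  ultimately have "p i \<notin> convex hull {p j, p k}" by blast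
  then have "p i extreme_point_of (convex hull (insert (p i) {p j, p k}))"
    by (intro extreme_point_of_convex_hull_insert) auto
  moreover have "J = insert i {j, k}"
    using insert_Diff[OF \<open>i \<in> J\<close>] jk(1) by simp
  ultimately show ?thesis by simp
qed

text \<open>A point slightly off the midpoint of the edge, on the positive side, lies in a triangle that
  also contains the midpoint; by the face condition this triangle contains the whole edge.\<close>

lemma triangle_on_side:
  assumes n: "2 \<le> n" and T: "polygon_triangulation n p T"
    and le: "i \<le> n" "j \<le> n" "k \<le> n" and pos: "0 < orient (p i) (p j) (p k)"
    and edge: "(\<exists>J\<in>T. i \<in> J \<and> j \<in> J)
      \<or> (\<forall>l\<le>n. l \<noteq> i \<longrightarrow> l \<noteq> j \<longrightarrow> 0 < orient (p i) (p j) (p l))"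
  shows "\<exists>l\<le>n. 0 < orient (p i) (p j) (p l) \<and> {i, j, l} \<in> T"
proof -
  define H where "H J = convex hull (p ` J)" for J
  have sub: "J \<subseteq> {..n}" and card: "card J = 3" if "J \<in> T" for J
    using T that by (auto simp: polygon_triangulation_def)
  have fin: "finite J" if "J \<in> T" for J using sub[OF that] finite_subset by blast
  have "finite T" using sub by (intro finite_subset[of T "Pow {..n}"]) auto
  have cover: "(\<Union>J\<in>T. H J) = convex hull (p ` {..n})"
    using T by (simp add: polygon_triangulation_def H_def)
  have face: "H J \<inter> H J' face_of H J" if "J \<in> T" "J' \<in> T" for J J'
    using T that by (auto simp: polygon_triangulation_def triangulation_def H_def)
  have "i \<noteq> j" using pos by auto
  then have pij: "p i \<noteq> p j" using polygon_inj_on[OF n] le by (auto dest: inj_onD)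
  define m where "m = midpoint (p i) (p j)"
  have m_seg: "m \<in> open_segment (p i) (p j)" using pij by (simp add: m_def)
  have m0: "orient (p i) (p j) m = 0"
    using orient_convex[of "1/2" "1/2" "p i" "p j" "p i" "p j"]
    by (simp add: m_def midpoint_def scaleR_add_right)
  \<comment> \<open>The finitely many triangles that miss m form a closed set, so a small enough
    push from m towards p k stays off it. Every triangle containing the pushed point then contains
    m.\<close>
  define K where "K = (\<Union>J\<in>{J\<in>T. m \<notin> H J}. H J)"
  have "closed K"
    unfolding K_def H_def using \<open>finite T\<close> fin
    by (intro closed_UN) (auto intro: compact_imp_closed finite_imp_compact_convex_hull)
  moreover have "m \<notin> K" by (auto simp: K_def)
  moreover have "((\<lambda>e. (1 - e) *\<^sub>R m + e *\<^sub>R p k) \<longlongrightarrow> (1 - 0) *\<^sub>R m + 0 *\<^sub>R p k) (at_right 0)"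
    by (intro tendsto_intros)
  ultimately have "\<forall>\<^sub>F e in at_right 0. (1 - e) *\<^sub>R m + e *\<^sub>R p k \<in> - K"
    by (intro topological_tendstoD) (auto simp: open_Compl)
  moreover have "\<forall>\<^sub>F e in at_right (0::real). 0 < e \<and> e < 1"
    using eventually_at_right_less[of 0] eventually_at_rightI[of 0 1 "\<lambda>e::real. e < 1"]
    by (auto elim: eventually_elim2)
  ultimately have "\<forall>\<^sub>F e in at_right 0. (1 - e) *\<^sub>R m + e *\<^sub>R p k \<in> - K \<and> 0 < e \<and> e < 1"
    by (rule eventually_conj)
  then obtain e where e: "(1 - e) *\<^sub>R m + e *\<^sub>R p k \<notin> K" "0 < e" "e < 1"
    using eventually_happens'[of "at_right (0::real)"] by auto
  define q where "q = (1 - e) *\<^sub>R m + e *\<^sub>R p k"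
  have q_pos: "0 < orient (p i) (p j) q"
    using e pos by (simp add: q_def orient_convex m0)
  have vert: "p l \<in> convex hull (p ` {..n})" if "l \<le> n" for l
    using that by (intro hull_inc) auto
  have m_in: "m \<in> convex hull (p ` {..n})"
    using m_seg vert[OF le(1)] vert[OF le(2)] convex_convex_hull[of "p ` {..n}"]
    by (meson closed_segment_subset open_closed_segment subsetD)
  then have "q \<in> convex hull (p ` {..n})"
    unfolding q_def using e vert[OF le(3)] by (intro convexD) auto
  then obtain J where J: "J \<in> T" "q \<in> H J" using cover by auto
  have mJ: "m \<in> H J" using J e(1) by (auto simp: K_def q_def)
  \<comment> \<open>An edge already present in T is handled by the face condition. A side of the
    polygon is not yet known to belong to any triangle; there its line supports the polygon, which
    replaces that condition.\<close>
  have ijJ: "i \<in> J \<and> j \<in> J"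
    using edge
  proof
    assume "\<exists>J\<in>T. i \<in> J \<and> j \<in> J"
    then obtain J' where J': "J' \<in> T" "i \<in> J'" "j \<in> J'" by blast
    have ij': "p i \<in> H J'" "p j \<in> H J'" using J' by (auto simp: H_def intro: hull_inc)
    then have "m \<in> H J'"
      using m_seg convex_convex_hull[of "p ` J'"] unfolding H_def
      by (meson closed_segment_subset open_closed_segment subsetD)
    \<comment> \<open>Defining property of a face: m is interior to the segment from p i to p j, so
      a face containing m contains both ends.\<close>
    then have ij: "p i \<in> H J' \<inter> H J \<and> p j \<in> H J' \<inter> H J"
      using face_ofD[OF face[OF J'(1) J(1)] m_seg] ij' mJ by blast
    \<comment> \<open>Being a point of H J is weaker than being one of its vertices. A vertex of J'
      is extreme in H J', hence in the common face, hence in H J, whose extreme points all come from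
      J.\<close>
    have *: "l \<in> J" if "l \<in> J'" "p l \<in> H J' \<inter> H J" for l
    proof -
      have "p l extreme_point_of H J'"
        using polygon_triangle_extreme_point[OF sub[OF J'(1)] card[OF J'(1)] that(1)]
        by (simp add: H_def)
      then have "p l extreme_point_of (H J' \<inter> H J)"
        using extreme_point_of_face[OF face[OF J'(1) J(1)]] that(2) by blast
      then have "p l extreme_point_of H J"
        using extreme_point_of_face[OF face[OF J(1) J'(1)]] by (simp add: Int_commute)
      then have "p l \<in> p ` J" unfolding H_def by (rule extreme_point_of_convex_hull)
      then obtain l' where "l' \<in> J" "p l = p l'" by auto
      moreover have "l' \<le> n" "l \<le> n" using calculation sub[OF J(1)] sub[OF J'(1)] that(1) by auto
      ultimately show ?thesis using polygon_inj_on[OF n] by (auto dest: inj_onD)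
    qed
    show ?thesis using * J' ij by blast
  next
    assume side: "\<forall>l\<le>n. l \<noteq> i \<longrightarrow> l \<noteq> j \<longrightarrow> 0 < orient (p i) (p j) (p l)"
    \<comment> \<open>If \<open>J\<close> misses an endpoint \<open>p a\<close>, then \<open>m\<close> is a convex combination of the other endpoint
      and a point off the line, or \<open>m\<close> equals that endpoint.\<close>
    have *: False if a: "a \<notin> J" and ab: "(a, b) = (i, j) \<or> (a, b) = (j, i)" for a b
    proof -
      have bn: "b \<le> n" using ab le by auto
      have pos': "p ` (J - {b}) \<subseteq> {c. 0 < orient (p i) (p j) c}"
        using side a ab sub[OF J(1)] by auto
      have hull_pos: "convex hull (p ` (J - {b})) \<subseteq> {c. 0 < orient (p i) (p j) c}"
        using pos' by (rule hull_minimal) (rule convex_orient_pos)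
      have "J - {b} \<noteq> {}" 
      proof
        assume "J - {b} = {}"
        then have "card J \<le> card {b}" by (intro card_mono) auto
        then show False using card[OF J(1)] by simp
      qed
      have "H J \<subseteq> convex hull (insert (p b) (p ` (J - {b})))"
        unfolding H_def by (intro hull_mono) auto
      then have "m \<in> convex hull (insert (p b) (p ` (J - {b})))" using mJ by blast
      then obtain u v c where uv: "0 \<le> u" "0 \<le> v" "u + v = 1"
        "c \<in> convex hull (p ` (J - {b}))" "m = u *\<^sub>R p b + v *\<^sub>R c"
        using \<open>J - {b} \<noteq> {}\<close> by (auto simp: convex_hull_insert)
      have ob: "orient (p i) (p j) (p b) = 0" using ab by auto
      have "v * orient (p i) (p j) c = 0"
        using m0 uv(3) ob by (simp add: uv(5) orient_convex)
      then have "v = 0" using hull_pos uv(4) by auto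
      then have "m = p b" using uv by simp
      then show False using m_seg ab by (auto simp: open_segment_def)
    qed
    show ?thesis using * by blast
  qed
  have "card (J - {i} - {j}) = 1"
    using card[OF J(1)] fin[OF J(1)] ijJ \<open>i \<noteq> j\<close> by simp
  then obtain l where "J - {i} - {j} = {l}" by (auto simp: card_1_singleton_iff)
  then have l: "J = {i, j, l}" using ijJ by blast
  \<comment> \<open>Otherwise the whole triangle would lie in the closed half-plane on the other
    side, away from q.\<close>
  have "0 < orient (p i) (p j) (p l)"
  proof (rule ccontr)
    assume "\<not> 0 < orient (p i) (p j) (p l)"
    then have "H J \<subseteq> {c. 0 \<le> orient (p j) (p i) c}"
      unfolding H_def l
      by (intro hull_minimal convex_orient_nonneg) (auto simp: orient_swap[of "p j" "p i"])
    then show False using J(2) q_pos orient_swap[of "p j" "p i" q] by auto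
  qed
  then show ?thesis using l J(1) sub[OF J(1)] by blast
qed

end

text \<open>What a triangulation of the $(n+1)$-gon provides: an edge of \<open>T\<close> borders a triangle on each
  of its two sides, except that a side of the polygon borders one on the inner side only. The
  members of \<open>T\<close> need not be triangles, so that $T = \{[n]\}$, i.e. $\Delta^n$ itself, is covered.\<close>

definition fillable :: "nat \<Rightarrow> nat set set \<Rightarrow> bool" where
  "fillable n T \<longleftrightarrow>
     (\<forall>J\<in>T. J \<subseteq> {..n}) \<and>
     (\<forall>i<n. \<exists>J\<in>T. i \<in> J \<and> Suc i \<in> J) \<and>
     (\<exists>J\<in>T. 0 \<in> J \<and> n \<in> J) \<and>
     (\<forall>J\<in>T. \<forall>i\<in>J. \<forall>j\<in>J. Suc i < j \<longrightarrow>
        (\<exists>k. i < k \<and> k < j \<and> (\<exists>J'\<in>T. {i, j, k} \<subseteq> J'))) \<and>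
     (\<forall>J\<in>T. \<forall>i\<in>J. \<forall>j\<in>J. i < j \<and> (i, j) \<noteq> (0, n) \<longrightarrow>
        (\<exists>k. (k < i \<or> j < k) \<and> (\<exists>J'\<in>T. {i, j, k} \<subseteq> J')))"

lemma fillableD:
  assumes "fillable n T"
  shows "\<lbrakk>J \<in> T; i \<in> J\<rbrakk> \<Longrightarrow> i \<le> n"
    and "i < n \<Longrightarrow> \<exists>J\<in>T. i \<in> J \<and> Suc i \<in> J"
    and "\<exists>J\<in>T. 0 \<in> J \<and> n \<in> J"
    and "\<lbrakk>J \<in> T; i \<in> J; j \<in> J; Suc i < j\<rbrakk>
      \<Longrightarrow> \<exists>k J'. i < k \<and> k < j \<and> J' \<in> T \<and> i \<in> J' \<and> j \<in> J' \<and> k \<in> J'"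
    and "\<lbrakk>J \<in> T; i \<in> J; j \<in> J; i < j; (i, j) \<noteq> (0, n)\<rbrakk>
      \<Longrightarrow> \<exists>k J'. (k < i \<or> j < k) \<and> J' \<in> T \<and> i \<in> J' \<and> j \<in> J' \<and> k \<in> J'"
proof -
  show "i \<le> n" if "J \<in> T" "i \<in> J"
    using assms that by (auto simp: fillable_def)
  show "\<exists>J\<in>T. i \<in> J \<and> Suc i \<in> J" if "i < n"
    using assms that by (simp add: fillable_def)
  show "\<exists>J\<in>T. 0 \<in> J \<and> n \<in> J"
    using assms by (simp add: fillable_def)
  show "\<exists>k J'. i < k \<and> k < j \<and> J' \<in> T \<and> i \<in> J' \<and> j \<in> J' \<and> k \<in> J'"
    if "J \<in> T" "i \<in> J" "j \<in> J" "Suc i < j"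
  proof -
    have "\<exists>k. i < k \<and> k < j \<and> (\<exists>J'\<in>T. {i, j, k} \<subseteq> J')"
      using assms that by (simp only: fillable_def)
    then show ?thesis by auto
  qed
  show "\<exists>k J'. (k < i \<or> j < k) \<and> J' \<in> T \<and> i \<in> J' \<and> j \<in> J' \<and> k \<in> J'"
    if "J \<in> T" "i \<in> J" "j \<in> J" "i < j" "(i, j) \<noteq> (0, n)"
  proof -
    have "\<forall>J\<in>T. \<forall>i\<in>J. \<forall>j\<in>J. i < j \<and> (i, j) \<noteq> (0, n) \<longrightarrow>
        (\<exists>k. (k < i \<or> j < k) \<and> (\<exists>J'\<in>T. {i, j, k} \<subseteq> J'))"
      using assms unfolding fillable_def by (elim conjE)
    from this[rule_format, OF that(1-3)] that(4,5)
    show ?thesis by auto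
  qed
qed

lemma fillable_polygon_triangulation:
  assumes n: "2 \<le> n" and p: "convex_polygon n p" and T: "polygon_triangulation n p T"
  shows "fillable n T"
proof -
  have sub: "J \<subseteq> {..n}" if "J \<in> T" for J
    using T that by (simp add: polygon_triangulation_def)
  note side = triangle_on_side[OF p n T]
  note pos = orient_polygon_pos_iff[OF p]
  have sides: "\<exists>J\<in>T. i \<in> J \<and> Suc i \<in> J" if "i < n" for i
  proof -
    \<comment> \<open>\<open>triangle_on_side\<close> asks for some vertex strictly inside the line
      of the side; 2 serves for i = 0 and 0 for all other i.\<close>
    obtain k where "k \<le> n" "k < i \<or> Suc i < k"
    proof (cases "i = 0")
      case True
      with n show thesis by (intro that[of 2]) auto
    next
      case False
      with n show thesis by (intro that[of 0]) auto
    qed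
    moreover have "0 < orient (p i) (p (Suc i)) (p l)" if "l \<le> n" "l < i \<or> Suc i < l" for l
      using that \<open>i < n\<close> pos(1)[of i "Suc i" l] by simp
    ultimately have "\<exists>l\<le>n. 0 < orient (p i) (p (Suc i)) (p l) \<and> {i, Suc i, l} \<in> T"
      using \<open>i < n\<close> by (intro side[of i "Suc i" k] disjI2) (simp_all add: linorder_neq_iff)
    then obtain l where "{i, Suc i, l} \<in> T" by blast
    then show ?thesis by (rule bexI[rotated]) simp
  qed
  have base: "\<exists>J\<in>T. 0 \<in> J \<and> n \<in> J"
  proof -
    \<comment> \<open>The closing side runs counterclockwise from n to 0, against the order of the
      labels, so the two points are swapped.\<close>
    have "0 < orient (p n) (p 0) (p l)" if "0 < l" "l < n" for l
      using that pos(2)[of 0 n l] by simp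
    then have "\<exists>l\<le>n. 0 < orient (p n) (p 0) (p l) \<and> {n, 0, l} \<in> T"
      using n by (intro side[of n 0 1] disjI2) simp_all
    then obtain l where "{n, 0, l} \<in> T" by blast
    then show ?thesis by (rule bexI[rotated]) simp
  qed
  have inner: "\<exists>k. i < k \<and> k < j \<and> (\<exists>J'\<in>T. {i, j, k} \<subseteq> J')"
    if "J \<in> T" "i \<in> J" "j \<in> J" "Suc i < j" for J i j
  proof -
    have "j \<le> n" using that(1,3) sub by blast
    have "\<exists>l\<le>n. 0 < orient (p j) (p i) (p l) \<and> {j, i, l} \<in> T"
      using that \<open>j \<le> n\<close> pos(2)[of i j "Suc i"] by (intro side[of j i "Suc i"] disjI1) auto
    then obtain l where l: "l \<le> n" "0 < orient (p j) (p i) (p l)" "{j, i, l} \<in> T" by blast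
    then have "i < l \<and> l < j" using pos(2)[of i j l] that(4) \<open>j \<le> n\<close> by simp
    then show ?thesis by (intro exI[of _ l] conjI bexI[OF _ l(3)]) auto
  qed
  have outer: "\<exists>k. (k < i \<or> j < k) \<and> (\<exists>J'\<in>T. {i, j, k} \<subseteq> J')"
    if "J \<in> T" "i \<in> J" "j \<in> J" "i < j" "(i, j) \<noteq> (0, n)" for J i j
  proof -
    have "j \<le> n" using that(1,3) sub by blast
    note assms_ij = that(4,5) \<open>j \<le> n\<close>
    obtain k where k: "k \<le> n" "k < i \<or> j < k"
    proof (cases "i = 0")
      case True
      with assms_ij show thesis by (intro that[of n]) auto
    next
      case False
      then show thesis by (intro that[of 0]) auto
    qed
    have "\<exists>l\<le>n. 0 < orient (p i) (p j) (p l) \<and> {i, j, l} \<in> T"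
      using that k \<open>j \<le> n\<close> pos(1)[of i j k] by (intro side[of i j k] disjI1) auto
    then obtain l where l: "l \<le> n" "0 < orient (p i) (p j) (p l)" "{i, j, l} \<in> T" by blast
    then have "l < i \<or> j < l" using pos(1)[of i j l] that(4) \<open>j \<le> n\<close> by simp
    then show ?thesis by (intro exI[of _ l] conjI bexI[OF _ l(3)]) auto
  qed
  show ?thesis
    unfolding fillable_def using sub sides base inner outer by (intro conjI ballI allI impI) simp_all
qed

lemma fillable_full: "fillable n {{..n}}"
proof -
  have out: "\<exists>k. (k < i \<or> j < k) \<and> k \<le> n" if "i < j" "j \<le> n" "(i, j) \<noteq> (0, n)" for i j
  proof (cases "i = 0")
    case True
    then show ?thesis using that by (intro exI[of _ n]) auto
  next
    case False
    then show ?thesis by (intro exI[of _ 0]) auto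
  qed
  have inner: "\<exists>k. i < k \<and> k < j \<and> k \<le> n" if "Suc i < j" "j \<le> n" for i j
    using that by (intro exI[of _ "Suc i"]) auto
  show ?thesis
    unfolding fillable_def using out inner by (simp add: conj_ac)
qed

subsection \<open>Subcomplexes of the standard simplex\<close>

lemma simplices_simplex_union_iff:
  "\<sigma> \<in> simplices (simplex_union T) k \<longleftrightarrow>
     (\<exists>J\<in>T. length \<sigma> = Suc k \<and> sorted \<sigma> \<and> set \<sigma> \<subseteq> J)"
  by (auto simp: simplex_union_def)

lemma nth_simplex_union:
  assumes "\<sigma> \<in> simplices (simplex_union T) k"
  obtains J where "J \<in> T" "length \<sigma> = Suc k" "\<And>l. l \<le> k \<Longrightarrow> \<sigma> ! l \<in> J"
    "\<And>l m. \<lbrakk>l \<le> m; m \<le> k\<rbrakk> \<Longrightarrow> \<sigma> ! l \<le> \<sigma> ! m"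
proof -
  from assms obtain J where J: "J \<in> T" "length \<sigma> = Suc k" "sorted \<sigma>" "set \<sigma> \<subseteq> J"
    by (auto simp: simplices_simplex_union_iff)
  show thesis
  proof (rule that[OF J(1,2)])
    show "\<sigma> ! l \<in> J" if "l \<le> k" for l
      using J(2,4) that nth_mem[of l \<sigma>] by (auto simp: less_Suc_eq_le)
    show "\<sigma> ! l \<le> \<sigma> ! m" if "l \<le> m" "m \<le> k" for l m
      using J(2,3) that by (auto simp: sorted_iff_nth_mono)
  qed
qed

lemma face_simplex_union: "face (simplex_union T) k i \<sigma> = take i \<sigma> @ drop (Suc i) \<sigma>"
  by (simp add: simplex_union_def)

lemma degen_simplex_union: "degen (simplex_union T) k i \<sigma> = take (Suc i) \<sigma> @ drop i \<sigma>"
  by (simp add: simplex_union_def)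

text \<open>The index map is the coface that omits the value i; in
  \<open>nth_degen_simplex_union\<close> it is the codegeneracy that takes the value i
  twice.\<close>

lemma nth_face_simplex_union:
  "\<lbrakk>length \<sigma> = Suc (Suc k); i \<le> Suc k; l \<le> k\<rbrakk>
    \<Longrightarrow> face (simplex_union T) m i \<sigma> ! l = \<sigma> ! (if l < i then l else Suc l)"
  by (auto simp: face_simplex_union nth_append min_def)

lemma nth_degen_simplex_union:
  "\<lbrakk>length \<sigma> = Suc k; i \<le> k; l \<le> Suc k\<rbrakk>
    \<Longrightarrow> degen (simplex_union T) m i \<sigma> ! l = \<sigma> ! (if l \<le> i then l else l - 1)"
  by (auto simp: degen_simplex_union nth_append min_def not_le)

lemma length_face_simplex_union:
  "\<lbrakk>length \<sigma> = Suc (Suc k); i \<le> Suc k\<rbrakk> \<Longrightarrow> length (face (simplex_union T) m i \<sigma>) = Suc k"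
  by (auto simp: face_simplex_union)

lemma length_degen_simplex_union:
  "\<lbrakk>length \<sigma> = Suc k; i \<le> k\<rbrakk> \<Longrightarrow> length (degen (simplex_union T) m i \<sigma>) = Suc (Suc k)"
  by (auto simp: degen_simplex_union)

text \<open>Deleting or repeating an entry keeps a list sorted and inside the same J. The identities
  are compared entry by entry, as equalities of composed index maps.\<close>

lemma simplicial_set_simplex_union: "simplicial_set (simplex_union T)"
proof
  fix \<sigma> n i assume s: "\<sigma> \<in> simplices (simplex_union T) (Suc n)" and i: "i \<le> Suc n"
  then obtain J where J: "J \<in> T" "length \<sigma> = Suc (Suc n)" "sorted \<sigma>" "set \<sigma> \<subseteq> J"
    by (auto simp: simplices_simplex_union_iff)
  have "sorted (face (simplex_union T) (Suc n) i \<sigma>)"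
    unfolding sorted_iff_nth_mono length_face_simplex_union[OF J(2) i]
    using J(2,3) i by (auto simp: nth_face_simplex_union less_Suc_eq_le intro!: sorted_nth_mono)
  moreover have "set (face (simplex_union T) (Suc n) i \<sigma>) \<subseteq> J"
    using J(4) by (auto simp: face_simplex_union dest: in_set_takeD in_set_dropD)
  ultimately show "face (simplex_union T) (Suc n) i \<sigma> \<in> simplices (simplex_union T) n"
    using J(1) length_face_simplex_union[OF J(2) i] by (auto simp: simplices_simplex_union_iff)
next
  fix \<sigma> n i assume s: "\<sigma> \<in> simplices (simplex_union T) n" and i: "i \<le> n"
  then obtain J where J: "J \<in> T" "length \<sigma> = Suc n" "sorted \<sigma>" "set \<sigma> \<subseteq> J"
    by (auto simp: simplices_simplex_union_iff)
  have "sorted (degen (simplex_union T) n i \<sigma>)"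
    unfolding sorted_iff_nth_mono length_degen_simplex_union[OF J(2) i]
    using J(2,3) i by (auto simp: nth_degen_simplex_union less_Suc_eq_le intro!: sorted_nth_mono)
  moreover have "set (degen (simplex_union T) n i \<sigma>) \<subseteq> J"
    using J(4) by (auto simp: degen_simplex_union dest: in_set_takeD in_set_dropD)
  ultimately show "degen (simplex_union T) n i \<sigma> \<in> simplices (simplex_union T) (Suc n)"
    using J(1) length_degen_simplex_union[OF J(2) i] by (auto simp: simplices_simplex_union_iff)
next
  fix \<sigma> n i and j :: nat
  assume "\<sigma> \<in> simplices (simplex_union T) (Suc (Suc n))" "i < j" "j \<le> Suc (Suc n)"
  then show "face (simplex_union T) (Suc n) i (face (simplex_union T) (Suc (Suc n)) j \<sigma>)
    = face (simplex_union T) (Suc n) (j - 1) (face (simplex_union T) (Suc (Suc n)) i \<sigma>)"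
    by (intro nth_equalityI)
       (auto simp: simplices_simplex_union_iff length_face_simplex_union less_Suc_eq_le
          nth_face_simplex_union)
next
  fix \<sigma> n i and j :: nat
  assume "\<sigma> \<in> simplices (simplex_union T) n" "i \<le> j" "j \<le> n"
  then show "degen (simplex_union T) (Suc n) i (degen (simplex_union T) n j \<sigma>)
    = degen (simplex_union T) (Suc n) (Suc j) (degen (simplex_union T) n i \<sigma>)"
    by (intro nth_equalityI)
       (auto simp: simplices_simplex_union_iff length_degen_simplex_union less_Suc_eq_le
          nth_degen_simplex_union)
next
  fix \<sigma> n i and j :: nat
  assume "\<sigma> \<in> simplices (simplex_union T) (Suc n)" "i < j" "j \<le> Suc n"
  then show "face (simplex_union T) (Suc (Suc n)) i (degen (simplex_union T) (Suc n) j \<sigma>)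
    = degen (simplex_union T) n (j - 1) (face (simplex_union T) (Suc n) i \<sigma>)"
    by (intro nth_equalityI)
       (auto simp: simplices_simplex_union_iff length_degen_simplex_union less_Suc_eq_le
          length_face_simplex_union nth_face_simplex_union nth_degen_simplex_union)
next
  fix \<sigma> n i and j :: nat
  assume "\<sigma> \<in> simplices (simplex_union T) n" "j \<le> n" "i = j \<or> i = Suc j"
  then show "face (simplex_union T) (Suc n) i (degen (simplex_union T) n j \<sigma>) = \<sigma>"
    by (intro nth_equalityI)
       (auto simp: simplices_simplex_union_iff length_degen_simplex_union less_Suc_eq_le
          length_face_simplex_union nth_face_simplex_union nth_degen_simplex_union)
next
  fix \<sigma> n i and j :: nat
  assume "\<sigma> \<in> simplices (simplex_union T) (Suc n)" "Suc j < i" "i \<le> Suc (Suc n)"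
  then show "face (simplex_union T) (Suc (Suc n)) i (degen (simplex_union T) (Suc n) j \<sigma>)
    = degen (simplex_union T) n j (face (simplex_union T) (Suc n) (i - 1) \<sigma>)"
    by (intro nth_equalityI)
       (auto simp: simplices_simplex_union_iff length_degen_simplex_union less_Suc_eq_le
          length_face_simplex_union nth_face_simplex_union nth_degen_simplex_union)
qed

lemma identity_simplex_in: "[0..<Suc n] \<in> simplices (simplex_union {{..n}}) n"
  by (auto simp: simplices_simplex_union_iff simp del: upt_Suc)

lemma sset_homD:
  assumes "g \<in> sset_hom X Y"
  shows "\<sigma> \<in> simplices X k \<Longrightarrow> g k \<sigma> \<in> simplices Y k"
    and "\<lbrakk>\<sigma> \<in> simplices X (Suc k); i \<le> Suc k\<rbrakk>
      \<Longrightarrow> g k (face X (Suc k) i \<sigma>) = face Y (Suc k) i (g (Suc k) \<sigma>)"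
    and "\<lbrakk>\<sigma> \<in> simplices X k; i \<le> k\<rbrakk> \<Longrightarrow> g (Suc k) (degen X k i \<sigma>) = degen Y k i (g k \<sigma>)"
  using assms by (auto simp: sset_hom_def)

text \<open>A map g commuting with faces and degeneracies carries each identity from X to the image
  of g. X and g may depend on the simplex, since an identity speaks of one simplex at a
  time.\<close>

lemma simplicial_set_if_covered:
  fixes Y :: "'a sset"
  assumes cover: "\<And>n y. y \<in> simplices Y n \<Longrightarrow> \<exists>(X :: 'b sset) g \<sigma>.
    simplicial_set X \<and> g \<in> sset_hom X Y \<and> \<sigma> \<in> simplices X n \<and> y = g n \<sigma>"
  shows "simplicial_set Y"
proof
  fix y n i assume y: "y \<in> simplices Y (Suc n)" and i: "i \<le> Suc n"
  obtain X :: "'b sset" and g \<sigma> where X: "simplicial_set X" and g: "g \<in> sset_hom X Y"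
    and \<sigma>: "\<sigma> \<in> simplices X (Suc n)" "y = g (Suc n) \<sigma>"
    using cover[OF y] by blast
  interpret simplicial_set X by fact
  show "face Y (Suc n) i y \<in> simplices Y n"
    using i \<sigma> by (simp add: sset_homD(2)[OF g, symmetric] sset_homD(1)[OF g] face_in)
next
  fix y n i assume y: "y \<in> simplices Y n" and i: "i \<le> n"
  obtain X :: "'b sset" and g \<sigma> where X: "simplicial_set X" and g: "g \<in> sset_hom X Y"
    and \<sigma>: "\<sigma> \<in> simplices X n" "y = g n \<sigma>"
    using cover[OF y] by blast
  interpret simplicial_set X by fact
  show "degen Y n i y \<in> simplices Y (Suc n)"
    using i \<sigma> by (simp add: sset_homD(3)[OF g, symmetric] sset_homD(1)[OF g] degen_in)
next
  fix y n i and j :: nat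
  assume y: "y \<in> simplices Y (Suc (Suc n))" and ij: "i < j" "j \<le> Suc (Suc n)"
  obtain X :: "'b sset" and g \<sigma> where X: "simplicial_set X" and g: "g \<in> sset_hom X Y"
    and \<sigma>: "\<sigma> \<in> simplices X (Suc (Suc n))" "y = g (Suc (Suc n)) \<sigma>"
    using cover[OF y] by blast
  interpret simplicial_set X by fact
  show "face Y (Suc n) i (face Y (Suc (Suc n)) j y)
    = face Y (Suc n) (j - 1) (face Y (Suc (Suc n)) i y)"
    using ij \<sigma> face_face[OF \<sigma>(1) ij] by (simp add: sset_homD(2)[OF g, symmetric] face_in)
next
  fix y n i and j :: nat
  assume y: "y \<in> simplices Y n" and ij: "i \<le> j" "j \<le> n"
  obtain X :: "'b sset" and g \<sigma> where X: "simplicial_set X" and g: "g \<in> sset_hom X Y"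
    and \<sigma>: "\<sigma> \<in> simplices X n" "y = g n \<sigma>"
    using cover[OF y] by blast
  interpret simplicial_set X by fact
  show "degen Y (Suc n) i (degen Y n j y) = degen Y (Suc n) (Suc j) (degen Y n i y)"
    using ij \<sigma> degen_degen[OF \<sigma>(1) ij] by (simp add: sset_homD(3)[OF g, symmetric] degen_in)
next
  fix y n i and j :: nat
  assume y: "y \<in> simplices Y (Suc n)" and ij: "i < j" "j \<le> Suc n"
  obtain X :: "'b sset" and g \<sigma> where X: "simplicial_set X" and g: "g \<in> sset_hom X Y"
    and \<sigma>: "\<sigma> \<in> simplices X (Suc n)" "y = g (Suc n) \<sigma>"
    using cover[OF y] by blast
  interpret simplicial_set X by fact
  show "face Y (Suc (Suc n)) i (degen Y (Suc n) j y) = degen Y n (j - 1) (face Y (Suc n) i y)"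
    using ij \<sigma> face_degen_less[OF \<sigma>(1) ij]
    by (simp add: sset_homD(2,3)[OF g, symmetric] face_in degen_in)
next
  fix y n i and j :: nat
  assume y: "y \<in> simplices Y n" and ij: "j \<le> n" "i = j \<or> i = Suc j"
  obtain X :: "'b sset" and g \<sigma> where X: "simplicial_set X" and g: "g \<in> sset_hom X Y"
    and \<sigma>: "\<sigma> \<in> simplices X n" "y = g n \<sigma>"
    using cover[OF y] by blast
  interpret simplicial_set X by fact
  have "i \<le> Suc n" using ij by auto
  then show "face Y (Suc n) i (degen Y n j y) = y"
    using ij(1) \<sigma> face_degen_same[OF \<sigma>(1) ij]
    by (simp add: sset_homD(2,3)[OF g, symmetric] degen_in)
next
  fix y n i and j :: nat
  assume y: "y \<in> simplices Y (Suc n)" and ij: "Suc j < i" "i \<le> Suc (Suc n)"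
  obtain X :: "'b sset" and g \<sigma> where X: "simplicial_set X" and g: "g \<in> sset_hom X Y"
    and \<sigma>: "\<sigma> \<in> simplices X (Suc n)" "y = g (Suc n) \<sigma>"
    using cover[OF y] by blast
  interpret simplicial_set X by fact
  show "face Y (Suc (Suc n)) i (degen Y (Suc n) j y) = degen Y n j (face Y (Suc n) (i - 1) y)"
    using ij \<sigma> face_degen_greater[OF \<sigma>(1) ij]
    by (simp add: sset_homD(2,3)[OF g, symmetric] face_in degen_in)
qed

subsection \<open>Maps to the twisted nerve\<close>

text \<open>The arrows along the sides of the polygon with vertex list \<sigma>, closed up by u_{ba}
  for b the last and a the first vertex.\<close>

definition chain_of :: "(nat \<Rightarrow> nat \<Rightarrow> 'm) \<Rightarrow> (nat \<Rightarrow> nat \<Rightarrow> 'm) \<Rightarrow> nat list \<Rightarrow> 'm list" where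
  "chain_of \<alpha> \<beta> \<sigma> = map (\<lambda>i. \<alpha> (\<sigma> ! i) (\<sigma> ! Suc i)) [0..<length \<sigma> - 1] @ [\<beta> (hd \<sigma>) (last \<sigma>)]"

lemma length_chain_of: "length \<sigma> = Suc k \<Longrightarrow> length (chain_of \<alpha> \<beta> \<sigma>) = Suc k"
  by (simp add: chain_of_def)

lemma nth_chain_of:
  assumes "length \<sigma> = Suc k" "l \<le> k"
  shows "chain_of \<alpha> \<beta> \<sigma> ! l
    = (if l < k then \<alpha> (\<sigma> ! l) (\<sigma> ! Suc l) else \<beta> (\<sigma> ! 0) (\<sigma> ! k))"
proof -
  have "\<sigma> \<noteq> []" using assms(1) by auto
  then show ?thesis
    using assms by (auto simp: chain_of_def nth_append hd_conv_nth last_conv_nth)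
qed

text \<open>The restriction gives the extensionality demanded by \<open>sset_hom\<close>, so that
  maps agreeing on simplices are equal.\<close>

definition hom_of ::
  "nat set set \<Rightarrow> (nat \<Rightarrow> nat \<Rightarrow> 'm) \<Rightarrow> (nat \<Rightarrow> nat \<Rightarrow> 'm) \<Rightarrow> nat \<Rightarrow> nat list \<Rightarrow> 'm list" where
  "hom_of T \<alpha> \<beta> k = restrict (chain_of \<alpha> \<beta>) (simplices (simplex_union T) k)"

text \<open>For $a \le b$, \<open>\<alpha> a b\<close> is the arrow $u_{ab}$ and \<open>\<beta> a b\<close> is $u_{ba}$.\<close>

locale cocycle = endofunctor C F
  for C :: "('o, 'm) cat" and F :: "('o, 'm) endo" +
  fixes T :: "nat set set"
    and x :: "nat \<Rightarrow> 'o"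
    and \<alpha> \<beta> :: "nat \<Rightarrow> nat \<Rightarrow> 'm"
  assumes x_in: "\<lbrakk>J \<in> T; a \<in> J\<rbrakk> \<Longrightarrow> x a \<in> Obj C"
    and alpha_in: "\<lbrakk>J \<in> T; a \<in> J; b \<in> J; a \<le> b\<rbrakk> \<Longrightarrow> \<alpha> a b \<in> Arr C"
    and Dom_alpha: "\<lbrakk>J \<in> T; a \<in> J; b \<in> J; a \<le> b\<rbrakk> \<Longrightarrow> Dom C (\<alpha> a b) = x a"
    and Cod_alpha: "\<lbrakk>J \<in> T; a \<in> J; b \<in> J; a \<le> b\<rbrakk> \<Longrightarrow> Cod C (\<alpha> a b) = x b"
    and beta_in: "\<lbrakk>J \<in> T; a \<in> J; b \<in> J; a \<le> b\<rbrakk> \<Longrightarrow> \<beta> a b \<in> Arr C"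
    and Dom_beta: "\<lbrakk>J \<in> T; a \<in> J; b \<in> J; a \<le> b\<rbrakk> \<Longrightarrow> Dom C (\<beta> a b) = x b"
    and Cod_beta: "\<lbrakk>J \<in> T; a \<in> J; b \<in> J; a \<le> b\<rbrakk> \<Longrightarrow> Cod C (\<beta> a b) = obj_map F (x a)"
    and alpha_same: "\<lbrakk>J \<in> T; a \<in> J\<rbrakk> \<Longrightarrow> \<alpha> a a = Id C (x a)"
    and alpha_alpha: "\<lbrakk>J \<in> T; a \<in> J; b \<in> J; c \<in> J; a \<le> b; b \<le> c\<rbrakk>
      \<Longrightarrow> Comp C (\<alpha> b c) (\<alpha> a b) = \<alpha> a c"
    and beta_alpha: "\<lbrakk>J \<in> T; a \<in> J; b \<in> J; c \<in> J; a \<le> b; b \<le> c\<rbrakk>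
      \<Longrightarrow> Comp C (\<beta> a c) (\<alpha> b c) = \<beta> a b"
    and alpha_beta: "\<lbrakk>J \<in> T; a \<in> J; b \<in> J; c \<in> J; a \<le> b; b \<le> c\<rbrakk>
      \<Longrightarrow> Comp C (arr_map F (\<alpha> a b)) (\<beta> a c) = \<beta> b c"

section \<open>Chains of the twisted nerve, entry by entry\<close>

lemma simplices_twisted_nerve_iff:
  "us \<in> simplices (twisted_nerve C F) n \<longleftrightarrow>
     length us = Suc n \<and> (\<forall>i\<le>n. us ! i \<in> Arr C) \<and>
     (\<forall>i<n. Cod C (us ! i) = Dom C (us ! Suc i)) \<and>
     Cod C (us ! n) = obj_map F (Dom C (us ! 0))"
  by (fastforce simp: twisted_nerve_def set_conv_nth less_Suc_eq_le subset_iff)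

lemma length_face_twisted_nerve:
  "\<lbrakk>length us = Suc (Suc n); i \<le> Suc n\<rbrakk> \<Longrightarrow> length (face (twisted_nerve C F) k i us) = Suc n"
  by (auto simp: twisted_nerve_def)

lemma nth_face_0_twisted_nerve:
  "\<lbrakk>length us = Suc (Suc n); l \<le> n\<rbrakk> \<Longrightarrow> face (twisted_nerve C F) k 0 us ! l
    = (if l < n then us ! Suc l else Comp C (arr_map F (us ! 0)) (us ! Suc n))"
  by (cases us; cases "us = []")
     (auto simp: twisted_nerve_def nth_append nth_butlast nth_tl last_conv_nth hd_conv_nth)

lemma nth_face_Suc_twisted_nerve:
  "\<lbrakk>length us = Suc (Suc n); i \<le> n; l \<le> n\<rbrakk> \<Longrightarrow> face (twisted_nerve C F) k (Suc i) us ! l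
    = (if l < i then us ! l else if l = i then Comp C (us ! Suc i) (us ! i) else us ! Suc l)"
  by (auto simp: twisted_nerve_def nth_append min_def)

lemma length_degen_twisted_nerve:
  "\<lbrakk>length us = Suc n; i \<le> n\<rbrakk> \<Longrightarrow> length (degen (twisted_nerve C F) k i us) = Suc (Suc n)"
  by (auto simp: twisted_nerve_def)

lemma nth_degen_twisted_nerve:
  "\<lbrakk>length us = Suc n; i \<le> n; l \<le> Suc n\<rbrakk> \<Longrightarrow> degen (twisted_nerve C F) k i us ! l
    = (if l < i then us ! l else if l = i then Id C (Dom C (us ! i)) else us ! (l - 1))"
  by (auto simp: twisted_nerve_def nth_append min_def nth_Cons')

context cocycle
begin

lemma chain_of_in:
  assumes "\<sigma> \<in> simplices (simplex_union T) k"
  shows "chain_of \<alpha> \<beta> \<sigma> \<in> simplices (twisted_nerve C F) k"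
proof -
  obtain J where J: "J \<in> T" "length \<sigma> = Suc k" "\<And>l. l \<le> k \<Longrightarrow> \<sigma> ! l \<in> J"
    "\<And>l m. \<lbrakk>l \<le> m; m \<le> k\<rbrakk> \<Longrightarrow> \<sigma> ! l \<le> \<sigma> ! m"
    using nth_simplex_union[OF assms] by blast
  \<comment> \<open>At i = k - 1 the chain passes from \<alpha> to the closing \<beta>, so
    composability there is a condition between the two families.\<close>
  have "Suc i = k" if "i < k" "\<not> Suc i < k" for i
    using that by simp
  then show ?thesis
    unfolding simplices_twisted_nerve_iff
    using J(2) by (fastforce simp: length_chain_of nth_chain_of J alpha_in[OF J(1)] beta_in[OF J(1)]
        Dom_alpha[OF J(1)] Cod_alpha[OF J(1)] Dom_beta[OF J(1)] Cod_beta[OF J(1)])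
qed

text \<open>Each cocycle relation accounts for one kind of face: \<open>alpha_beta\<close> for face
  0, \<open>alpha_alpha\<close> for the inner faces, \<open>beta_alpha\<close> for the last
  one.\<close>

lemma face_chain_of:
  assumes "\<sigma> \<in> simplices (simplex_union T) (Suc k)" "i \<le> Suc k"
  shows "face (twisted_nerve C F) (Suc k) i (chain_of \<alpha> \<beta> \<sigma>)
    = chain_of \<alpha> \<beta> (face (simplex_union T) (Suc k) i \<sigma>)"
proof -
  obtain J where J: "J \<in> T" "length \<sigma> = Suc (Suc k)" "\<And>l. l \<le> Suc k \<Longrightarrow> \<sigma> ! l \<in> J"
    "\<And>l m. \<lbrakk>l \<le> m; m \<le> Suc k\<rbrakk> \<Longrightarrow> \<sigma> ! l \<le> \<sigma> ! m"
    using nth_simplex_union[OF assms(1)] by blast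
  note len = length_chain_of[OF J(2), of \<alpha> \<beta>] length_face_simplex_union[OF J(2) assms(2), of T "Suc k"]
  show ?thesis
  proof (rule nth_equalityI)
    show "length (face (twisted_nerve C F) (Suc k) i (chain_of \<alpha> \<beta> \<sigma>))
      = length (chain_of \<alpha> \<beta> (face (simplex_union T) (Suc k) i \<sigma>))"
      using len assms(2) by (simp add: length_face_twisted_nerve length_chain_of)
    fix l assume "l < length (face (twisted_nerve C F) (Suc k) i (chain_of \<alpha> \<beta> \<sigma>))"
    then have l: "l \<le> k" using len assms(2) by (simp add: length_face_twisted_nerve)
    show "face (twisted_nerve C F) (Suc k) i (chain_of \<alpha> \<beta> \<sigma>) ! l
      = chain_of \<alpha> \<beta> (face (simplex_union T) (Suc k) i \<sigma>) ! l"
    proof (cases i)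
      case 0
      then show ?thesis
        using l J(2) len(2) alpha_beta[OF J(1)] J(3,4)
        by (auto simp: nth_face_0_twisted_nerve[OF len(1)] nth_chain_of nth_face_simplex_union)
    next
      case (Suc i')
      then have i': "i' \<le> k" using assms(2) by simp
      show ?thesis
        unfolding Suc nth_face_Suc_twisted_nerve[OF len(1) i' l]
        using l i' J(2) len(2) Suc
        by (auto simp: nth_chain_of nth_face_simplex_union not_less alpha_alpha[OF J(1)] beta_alpha[OF J(1)] J(3,4))
    qed
  qed
qed

lemma degen_chain_of:
  assumes "\<sigma> \<in> simplices (simplex_union T) k" "i \<le> k"
  shows "degen (twisted_nerve C F) k i (chain_of \<alpha> \<beta> \<sigma>)
    = chain_of \<alpha> \<beta> (degen (simplex_union T) k i \<sigma>)"
proof -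
  obtain J where J: "J \<in> T" "length \<sigma> = Suc k" "\<And>l. l \<le> k \<Longrightarrow> \<sigma> ! l \<in> J"
    "\<And>l m. \<lbrakk>l \<le> m; m \<le> k\<rbrakk> \<Longrightarrow> \<sigma> ! l \<le> \<sigma> ! m"
    using nth_simplex_union[OF assms(1)] by blast
  note len = length_chain_of[OF J(2), of \<alpha> \<beta>] length_degen_simplex_union[OF J(2) assms(2), of T k]
  show ?thesis
  proof (rule nth_equalityI)
    show "length (degen (twisted_nerve C F) k i (chain_of \<alpha> \<beta> \<sigma>))
      = length (chain_of \<alpha> \<beta> (degen (simplex_union T) k i \<sigma>))"
      using len assms(2) by (simp add: length_degen_twisted_nerve length_chain_of)
    fix l assume "l < length (degen (twisted_nerve C F) k i (chain_of \<alpha> \<beta> \<sigma>))"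
    then have l: "l \<le> Suc k" using len assms(2) by (simp add: length_degen_twisted_nerve)
    \<comment> \<open>The inserted identity sits at the domain of entry i. This is vertex i also for
      i = k, since the closing arrow starts at the last vertex.\<close>
    have "Dom C (chain_of \<alpha> \<beta> \<sigma> ! i) = x (\<sigma> ! i)"
      using assms(2) J by (auto simp: nth_chain_of Dom_alpha[OF J(1)] Dom_beta[OF J(1)])
    then show "degen (twisted_nerve C F) k i (chain_of \<alpha> \<beta> \<sigma>) ! l
      = chain_of \<alpha> \<beta> (degen (simplex_union T) k i \<sigma>) ! l"
      unfolding nth_degen_twisted_nerve[OF len(1) assms(2) l]
      using l assms(2) J(2) len(2)
      by (auto simp: nth_chain_of nth_degen_simplex_union not_less not_le alpha_same[OF J(1)] J(3))
  qed
qed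

lemma hom_of_in: "hom_of T \<alpha> \<beta> \<in> sset_hom (simplex_union T) (twisted_nerve C F)"
proof -
  interpret X: simplicial_set "simplex_union T"
    by (rule simplicial_set_simplex_union)
  show ?thesis
    by (auto simp: sset_hom_def hom_of_def chain_of_in face_chain_of degen_chain_of
        X.face_in X.degen_in)
qed

end

lemma chain_of_cong:
  assumes "length \<sigma> = Suc k"
    "\<And>l. l < k \<Longrightarrow> \<alpha> (\<sigma> ! l) (\<sigma> ! Suc l) = \<alpha>' (\<sigma> ! l) (\<sigma> ! Suc l)"
    "\<beta> (\<sigma> ! 0) (\<sigma> ! k) = \<beta>' (\<sigma> ! 0) (\<sigma> ! k)"
  shows "chain_of \<alpha> \<beta> \<sigma> = chain_of \<alpha>' \<beta>' \<sigma>"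
  using assms by (intro nth_equalityI) (auto simp: length_chain_of nth_chain_of)

lemma hom_of_cong:
  assumes "\<And>J a b. \<lbrakk>J \<in> T; a \<in> J; b \<in> J; a \<le> b\<rbrakk> \<Longrightarrow> \<alpha> a b = \<alpha>' a b \<and> \<beta> a b = \<beta>' a b"
  shows "hom_of T \<alpha> \<beta> = hom_of T \<alpha>' \<beta>'"
proof
  fix k show "hom_of T \<alpha> \<beta> k = hom_of T \<alpha>' \<beta>' k"
    unfolding hom_of_def
  proof (rule restrict_ext)
    fix \<sigma> assume "\<sigma> \<in> simplices (simplex_union T) k"
    then obtain J where J: "J \<in> T" "length \<sigma> = Suc k" "\<And>l. l \<le> k \<Longrightarrow> \<sigma> ! l \<in> J"
      "\<And>l m. \<lbrakk>l \<le> m; m \<le> k\<rbrakk> \<Longrightarrow> \<sigma> ! l \<le> \<sigma> ! m"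
      using nth_simplex_union by blast
    show "chain_of \<alpha> \<beta> \<sigma> = chain_of \<alpha>' \<beta>' \<sigma>"
      using J(2) by (rule chain_of_cong) (use J(3,4) assms[OF J(1)] in auto)
  qed
qed

lemma hom_of_edge:
  assumes "J \<in> T" "a \<in> J" "b \<in> J" "a \<le> b"
  shows "hom_of T \<alpha> \<beta> (Suc 0) [a, b] = [\<alpha> a b, \<beta> a b]"
  using assms by (auto simp: hom_of_def chain_of_def simplices_simplex_union_iff)

text \<open>The objects need no comparison in advance: x and x' are recovered as domains of arrows
  already known to agree.\<close>

lemma cocycle_unique:
  assumes "fillable n T" "0 < n"
    and "cocycle C F T x \<alpha> \<beta>" "cocycle C F T x' \<alpha>' \<beta>'"
    and side: "\<And>i. i < n \<Longrightarrow> \<alpha> i (Suc i) = \<alpha>' i (Suc i)" and last: "\<beta> 0 n = \<beta>' 0 n"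
    and "J \<in> T" "a \<in> J" "b \<in> J" "a \<le> b"
  shows "\<alpha> a b = \<alpha>' a b \<and> \<beta> a b = \<beta>' a b"
proof -
  interpret c: cocycle C F T x \<alpha> \<beta> by fact
  interpret c': cocycle C F T x' \<alpha>' \<beta>' by fact
  have le: "i \<le> n" if "J \<in> T" "i \<in> J" for i J
    using fillableD(1)[OF assms(1)] that by blast
  have \<alpha>_less: "\<alpha> a b = \<alpha>' a b" if "J \<in> T" "a \<in> J" "b \<in> J" "a < b" for J a b
    using that
  proof (induction "b - a" arbitrary: J a b rule: less_induct)
    case less
    show ?case
    proof (cases "b = Suc a")
      case True
      then show ?thesis using side[of a] le[OF less.prems(1,3)] by simp
    next
      case False
      then obtain k J' where k: "a < k" "k < b" "J' \<in> T" "a \<in> J'" "b \<in> J'" "k \<in> J'"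
        using fillableD(4)[OF assms(1) less.prems(1-3)] less.prems(4) by (metis Suc_lessI)
      then have "\<alpha> a k = \<alpha>' a k" "\<alpha> k b = \<alpha>' k b"
        using less.hyps[of k a J'] less.hyps[of b k J'] by auto
      then show ?thesis
        using c.alpha_alpha[of J' a k b] c'.alpha_alpha[of J' a k b] k by simp
    qed
  qed
  have \<beta>_less: "\<beta> a b = \<beta>' a b" if "J \<in> T" "a \<in> J" "b \<in> J" "a < b" for J a b
    using that
  proof (induction "n - (b - a)" arbitrary: J a b rule: less_induct)
    case less
    have bn: "b \<le> n" using le[OF less.prems(1,3)] .
    show ?case
    proof (cases "(a, b) = (0, n)")
      case True
      then show ?thesis using last by simp
    next
      case False
      then obtain k J' where k: "k < a \<or> b < k" "J' \<in> T" "a \<in> J'" "b \<in> J'" "k \<in> J'"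
        using fillableD(5)[OF assms(1) less.prems] by blast
      note kn = le[OF k(2,5)]
      \<comment> \<open>For k < a, \<beta> a b is F(\<alpha> k a) after \<beta> k b; for b < k it is
        \<beta> a k after \<alpha> b k. The new edge is longer, and as it stays within [n] the
        truncated difference \<open>n - (b - a)\<close> really drops.\<close>
      from k(1) show ?thesis
      proof
        assume "k < a"
        then have "\<beta> k b = \<beta>' k b" "\<alpha> k a = \<alpha>' k a"
          using less.hyps[of b k J'] k less.prems(4) bn \<alpha>_less[of J' k a] by auto
        then show ?thesis
          using c.alpha_beta[of J' k a b] c'.alpha_beta[of J' k a b] k \<open>k < a\<close> less.prems(4) by simp
      next
        assume "b < k"
        then have "\<beta> a k = \<beta>' a k" "\<alpha> b k = \<alpha>' b k"
          using less.hyps[of k a J'] k less.prems(4) kn \<alpha>_less[of J' b k] by auto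
        then show ?thesis
          using c.beta_alpha[of J' a b k] c'.beta_alpha[of J' a b k] k \<open>b < k\<close> less.prems(4) by simp
      qed
    qed
  qed
  \<comment> \<open>Degenerate edges lie outside both inductions, and \<beta> a a is an arrow from
    x_a to F(x_a), not fixed by x. For a < n it is \<beta> a (a+1) after \<alpha> a (a+1); at n,
    where no such side starts, it is F(\<alpha> 0 n) after \<beta> 0 n.\<close>
  have same: "\<alpha> a a = \<alpha>' a a \<and> \<beta> a a = \<beta>' a a" if "J \<in> T" "a \<in> J" for J a
  proof (cases "a = n")
    case True
    obtain J' where J': "J' \<in> T" "0 \<in> J'" "n \<in> J'"
      using fillableD(3)[OF assms(1)] by blast
    have "x n = x' n"
      using c.Dom_beta[OF J'] c'.Dom_beta[OF J'] last by simp
    then show ?thesis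
      using c.alpha_beta[OF J'(1,2,3,3)] c'.alpha_beta[OF J'(1,2,3,3)] \<alpha>_less[OF J' assms(2)] last
        c.alpha_same[OF J'(1,3)] c'.alpha_same[OF J'(1,3)] True by simp
  next
    case False
    then have "a < n" using le[OF that] by simp
    then obtain J' where J': "J' \<in> T" "a \<in> J'" "Suc a \<in> J'"
      using fillableD(2)[OF assms(1) \<open>a < n\<close>] by blast
    have "x a = x' a"
      using c.Dom_alpha[OF J'] c'.Dom_alpha[OF J'] side[OF \<open>a < n\<close>] by simp
    then show ?thesis
      using c.beta_alpha[OF J'(1,2,2,3)] c'.beta_alpha[OF J'(1,2,2,3)] \<beta>_less[OF J']
        side[OF \<open>a < n\<close>] c.alpha_same[OF J'(1,2)] c'.alpha_same[OF J'(1,2)] by simp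
  qed
  show ?thesis
    using \<alpha>_less[OF assms(7-9)] \<beta>_less[OF assms(7-9)] same[OF assms(7,8)] assms(10)
    by (cases "a = b") simp_all
qed

section \<open>From simplicial maps to edge data\<close>

context endofunctor
begin

text \<open>Values on edges give \<alpha> and \<beta>, values on vertices give x, and the faces of
  triangles give the relations. From dimension 2 on, every arrow of a chain survives unchanged in
  some face, so induction on the dimension fixes the remaining values.\<close>

lemma cocycle_of_hom:
  assumes g: "g \<in> sset_hom (simplex_union T) (twisted_nerve C F)"
  obtains x \<alpha> \<beta> where "cocycle C F T x \<alpha> \<beta>" "g = hom_of T \<alpha> \<beta>"
proof -
  let ?X = "simplex_union T" and ?Y = "twisted_nerve C F"
  note g_in = sset_homD(1)[OF g] and g_face = sset_homD(2)[OF g] and g_degen = sset_homD(3)[OF g]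
  define \<alpha> where "\<alpha> a b = g 1 [a, b] ! 0" for a b
  define \<beta> where "\<beta> a b = g 1 [a, b] ! 1" for a b
  define x where "x a = Dom C (g 0 [a] ! 0)" for a
  have vertex: "[a] \<in> simplices ?X 0" if "J \<in> T" "a \<in> J" for J a
    using that by (auto simp: simplices_simplex_union_iff)
  have edge: "[a, b] \<in> simplices ?X (Suc 0)" if "J \<in> T" "a \<in> J" "b \<in> J" "a \<le> b" for J a b
    using that by (auto simp: simplices_simplex_union_iff)
  have tri: "[a, b, c] \<in> simplices ?X (Suc (Suc 0))"
    if "J \<in> T" "a \<in> J" "b \<in> J" "c \<in> J" "a \<le> b" "b \<le> c" for J a b c
    using that by (auto simp: simplices_simplex_union_iff)
  have g_edge: "g (Suc 0) [a, b] = [\<alpha> a b, \<beta> a b]" if "J \<in> T" "a \<in> J" "b \<in> J" "a \<le> b" for J a b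
    using g_in[OF edge[OF that]] unfolding simplices_twisted_nerve_iff \<alpha>_def \<beta>_def
    by (auto intro!: nth_equalityI simp: less_Suc_eq)
  have edge_facts: "\<alpha> a b \<in> Arr C \<and> \<beta> a b \<in> Arr C \<and> Cod C (\<alpha> a b) = Dom C (\<beta> a b)
      \<and> Cod C (\<beta> a b) = obj_map F (Dom C (\<alpha> a b)) \<and> Dom C (\<alpha> a b) = x a \<and> Dom C (\<beta> a b) = x b"
    if "J \<in> T" "a \<in> J" "b \<in> J" "a \<le> b" for J a b
  proof -
    have *: "\<alpha> a b \<in> Arr C" "\<beta> a b \<in> Arr C" "Cod C (\<alpha> a b) = Dom C (\<beta> a b)"
      "Cod C (\<beta> a b) = obj_map F (Dom C (\<alpha> a b))"
      using g_in[OF edge[OF that]] unfolding simplices_twisted_nerve_iff g_edge[OF that]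
      by (auto simp: less_Suc_eq le_Suc_eq)
    \<comment> \<open>Face 1 deletes b and face 0 deletes a; comparing domains of the two composites
      yields x a and x b.\<close>
    have "g 0 [a] = [Comp C (\<beta> a b) (\<alpha> a b)]" "g 0 [b] = [Comp C (arr_map F (\<alpha> a b)) (\<beta> a b)]"
      using g_face[OF edge[OF that], of 1] g_face[OF edge[OF that], of 0] g_edge[OF that]
      by (auto simp: face_simplex_union twisted_nerve_def)
    then show ?thesis
      using * by (simp add: x_def Dom_Comp arr_map_in Dom_arr_map)
  qed
  have g_vertex: "\<alpha> a a = Id C (x a) \<and> g 0 [a] = [\<beta> a a]" if "J \<in> T" "a \<in> J" for J a
  proof -
    have "length (g 0 [a]) = Suc 0"
      using g_in[OF vertex[OF that]] by (simp add: simplices_twisted_nerve_iff)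
    then obtain u where u: "g 0 [a] = [u]" by (auto simp: length_Suc_conv)
    then show ?thesis
      using g_degen[OF vertex[OF that], of 0] g_edge[OF that(1,2,2)]
      by (simp add: degen_simplex_union twisted_nerve_def x_def)
  qed
  have tri_facts: "Comp C (\<alpha> b c) (\<alpha> a b) = \<alpha> a c \<and> Comp C (\<beta> a c) (\<alpha> b c) = \<beta> a b
      \<and> Comp C (arr_map F (\<alpha> a b)) (\<beta> a c) = \<beta> b c"
    if "J \<in> T" "a \<in> J" "b \<in> J" "c \<in> J" "a \<le> b" "b \<le> c" for J a b c
  proof -
    have "length (g 2 [a, b, c]) = 3"
      using g_in[OF tri[OF that]] by (simp add: simplices_twisted_nerve_iff numeral_2_eq_2 numeral_3_eq_3)
    then obtain u v w where u: "g (Suc (Suc 0)) [a, b, c] = [u, v, w]"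
      by (auto simp: numeral_2_eq_2 numeral_3_eq_3 length_Suc_conv)
    have "g (Suc 0) [b, c] = [v, Comp C (arr_map F u) w]" "g (Suc 0) [a, c] = [Comp C v u, w]"
      "g (Suc 0) [a, b] = [u, Comp C w v]"
      using g_face[OF tri[OF that], of 0] g_face[OF tri[OF that], of 1]
        g_face[OF tri[OF that], of 2] u
      by (simp_all add: face_simplex_union twisted_nerve_def)
    then show ?thesis
      using that g_edge[of J a b] g_edge[of J b c] g_edge[of J a c] by auto
  qed
  have coc: "cocycle C F T x \<alpha> \<beta>"
  proof unfold_locales
    show "x a \<in> Obj C" if "J \<in> T" "a \<in> J" for J a
      using edge_facts[OF that(1,2,2)] Dom_in by fastforce
  qed (use edge_facts g_vertex tri_facts in \<open>metis+\<close>)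
  interpret cocycle C F T x \<alpha> \<beta> by fact
  interpret X: simplicial_set ?X by (rule simplicial_set_simplex_union)
  have *: "g k \<sigma> = chain_of \<alpha> \<beta> \<sigma>" if "\<sigma> \<in> simplices ?X k" for k \<sigma>
    using that
  proof (induction k arbitrary: \<sigma>)
    case 0
    then obtain J a where "J \<in> T" "a \<in> J" "\<sigma> = [a]"
      by (auto simp: simplices_simplex_union_iff length_Suc_conv)
    then show ?case
      using g_vertex[of J a] by (simp add: chain_of_def)
  next
    case (Suc k)
    show ?case
    \<comment> \<open>Edges are a base case of their own: both faces of an edge compose its two
      arrows, so its arrows cannot be read off from them.\<close>
    proof (cases k)
      case 0
      then obtain J a b where "J \<in> T" "a \<in> J" "b \<in> J" "a \<le> b" "\<sigma> = [a, b]"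
        using Suc.prems by (auto simp: simplices_simplex_union_iff length_Suc_conv)
      then show ?thesis
        using g_edge[of J a b] 0 by (simp add: chain_of_def)
    next
      case (Suc m)
      have eq: "face ?Y (Suc k) i (g (Suc k) \<sigma>) = face ?Y (Suc k) i (chain_of \<alpha> \<beta> \<sigma>)"
        if "i \<le> Suc k" for i
        using Suc.IH[OF X.face_in[OF Suc.prems that]] g_face[OF Suc.prems that]
          face_chain_of[OF Suc.prems that] by simp
      have len: "length (g (Suc k) \<sigma>) = Suc (Suc k)"
        using g_in[OF Suc.prems] by (simp add: simplices_twisted_nerve_iff)
      have len': "length (chain_of \<alpha> \<beta> \<sigma>) = Suc (Suc k)"
        using chain_of_in[OF Suc.prems] by (simp add: simplices_twisted_nerve_iff)
      show ?thesis
      proof (rule nth_equalityI)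
        show "length (g (Suc k) \<sigma>) = length (chain_of \<alpha> \<beta> \<sigma>)" by (simp add: len len')
        fix l assume "l < length (g (Suc k) \<sigma>)"
        then consider "l < k" | "l = k" | "l = Suc k" using len by linarith
        then show "g (Suc k) \<sigma> ! l = chain_of \<alpha> \<beta> \<sigma> ! l"
        \<comment> \<open>The last face keeps all arrows before index k, face 0 moves arrow k to
          index m = k - 1, and face 1 moves the closing arrow to index k. The last two use k >
          0.\<close>
        proof cases
          case 1
          then show ?thesis
            using arg_cong[OF eq[of "Suc k"], of "\<lambda>us. us ! l"]
            by (simp add: nth_face_Suc_twisted_nerve[OF len] nth_face_Suc_twisted_nerve[OF len'])
        next
          case 2
          then show ?thesis
            using arg_cong[OF eq[of 0], of "\<lambda>us. us ! m"] Suc[symmetric]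
            by (simp add: nth_face_0_twisted_nerve[OF len] nth_face_0_twisted_nerve[OF len'])
        next
          case 3
          then show ?thesis
            using arg_cong[OF eq[of "Suc 0"], of "\<lambda>us. us ! k"] Suc[symmetric]
            by (simp add: nth_face_Suc_twisted_nerve[OF len] nth_face_Suc_twisted_nerve[OF len'])
        qed
      qed
    qed
  qed
  have "g k \<in> extensional (simplices ?X k)" for k
    using g by (auto simp: sset_hom_def PiE_def)
  then have "g = hom_of T \<alpha> \<beta>"
    using * by (intro ext) (auto simp: hom_of_def restrict_def extensional_def)
  with coc show thesis by (rule that)
qed

end

subsection \<open>The 2-Segal property\<close>

text \<open>Source and number of arrows, rather than source and target, are the parameters, so that
  the recursion is primitive and a + d = n is a legitimate endpoint.\<close>

primrec arrow_comp :: "('o, 'm) cat \<Rightarrow> 'm list \<Rightarrow> nat \<Rightarrow> nat \<Rightarrow> 'm" where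
  "arrow_comp C us a 0 = Id C (Dom C (us ! a))"
| "arrow_comp C us a (Suc d) = Comp C (us ! (a + d)) (arrow_comp C us a d)"

definition chain_alpha :: "('o, 'm) cat \<Rightarrow> 'm list \<Rightarrow> nat \<Rightarrow> nat \<Rightarrow> 'm" where
  "chain_alpha C us a b = arrow_comp C us a (b - a)"

text \<open>This is u_{ba} = F(u_{0a}) u_{n0} u_{bn}, with \<open>last us\<close> for u_{n0} and
  \<open>length us - 1\<close> for n. It is forced by the relations for the triples 0, a, b and 0,
  b, n.\<close>

definition chain_beta :: "('o, 'm) cat \<Rightarrow> ('o, 'm) endo \<Rightarrow> 'm list \<Rightarrow> nat \<Rightarrow> nat \<Rightarrow> 'm" where
  "chain_beta C F us a b = Comp C (arr_map F (chain_alpha C us 0 a))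
     (Comp C (last us) (chain_alpha C us b (length us - 1)))"

section \<open>The edge data generated by a chain\<close>

context endofunctor
begin

lemma arrow_comp_facts:
  assumes us: "us \<in> simplices (twisted_nerve C F) n" and "a + d \<le> n"
  shows "arrow_comp C us a d \<in> Arr C \<and> Dom C (arrow_comp C us a d) = Dom C (us ! a) \<and>
    Cod C (arrow_comp C us a d) = Dom C (us ! (a + d))"
  using assms(2)
proof (induction d)
  case 0
  then show ?case
    using us by (simp add: simplices_twisted_nerve_iff Dom_in Id_in Dom_Id Cod_Id)
next
  case (Suc d)
  then show ?case
    using us by (simp add: simplices_twisted_nerve_iff Comp_in Dom_Comp Cod_Comp)
qed

lemma arrow_comp_add:
  assumes us: "us \<in> simplices (twisted_nerve C F) n" and "a + d + e \<le> n"
  shows "Comp C (arrow_comp C us (a + d) e) (arrow_comp C us a d) = arrow_comp C us a (d + e)"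
  using assms(2)
proof (induction e)
  case 0
  then show ?case
    using arrow_comp_facts[OF us, of a d] Comp_Id_left[of "arrow_comp C us a d"] by simp
next
  case (Suc e)
  then have "us ! (a + d + e) \<in> Arr C"
    using us by (simp add: simplices_twisted_nerve_iff)
  then show ?case
    using Suc arrow_comp_facts[OF us, of a d] arrow_comp_facts[OF us, of "a + d" e]
    by (simp add: Comp_assoc[symmetric] add.assoc)
qed

text \<open>The formulas make sense for all pairs in [n], so the same data gives a map on the
  standard simplex and on each of its subcomplexes.\<close>

lemma cocycle_chain:
  assumes us: "us \<in> simplices (twisted_nerve C F) n" and T: "\<And>J. J \<in> T \<Longrightarrow> J \<subseteq> {..n}"
  shows "cocycle C F T (\<lambda>a. Dom C (us ! a)) (chain_alpha C us) (chain_beta C F us)"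
proof -
  have len: "length us = Suc n" using us by (simp add: simplices_twisted_nerve_iff)
  then have last: "last us = us ! n" using last_conv_nth[of us] by fastforce
  have u: "us ! n \<in> Arr C" "Cod C (us ! n) = obj_map F (Dom C (us ! 0))"
    using us by (auto simp: simplices_twisted_nerve_iff)
  have \<alpha>: "chain_alpha C us a b \<in> Arr C" "Dom C (chain_alpha C us a b) = Dom C (us ! a)"
    "Cod C (chain_alpha C us a b) = Dom C (us ! b)" if "a \<le> b" "b \<le> n" for a b
    using arrow_comp_facts[OF us, of a "b - a"] that by (auto simp: chain_alpha_def)
  have \<alpha>\<alpha>: "Comp C (chain_alpha C us b c) (chain_alpha C us a b) = chain_alpha C us a c"
    if "a \<le> b" "b \<le> c" "c \<le> n" for a b c
    using arrow_comp_add[OF us, of a "b - a" "c - b"] that by (simp add: chain_alpha_def)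
  note F_simps = arr_map_in Dom_arr_map Cod_arr_map
  note comp_simps = Comp_in Dom_Comp Cod_Comp
  \<comment> \<open>Splitting off \<gamma> b = u_{n0} u_{bn} separates the two indices of \<beta>:
    composing on the right with \<alpha> changes only \<gamma>, and composing on the left with
    F(\<alpha>) changes only the factor F(u_{0a}), by functoriality.\<close>
  define \<gamma> where "\<gamma> b = Comp C (us ! n) (chain_alpha C us b n)" for b
  have \<beta>_eq: "chain_beta C F us a b = Comp C (arr_map F (chain_alpha C us 0 a)) (\<gamma> b)" for a b
    by (simp add: chain_beta_def \<gamma>_def len last)
  have \<gamma>: "\<gamma> b \<in> Arr C" "Dom C (\<gamma> b) = Dom C (us ! b)" "Cod C (\<gamma> b) = obj_map F (Dom C (us ! 0))"
    if "b \<le> n" for b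
    using that u \<alpha>[of b n] by (simp_all add: \<gamma>_def comp_simps)
  have \<gamma>\<alpha>: "Comp C (\<gamma> c) (chain_alpha C us b c) = \<gamma> b" if "b \<le> c" "c \<le> n" for b c
    using that u \<alpha>[of b c] \<alpha>[of c n] by (simp add: \<gamma>_def Comp_assoc[symmetric] \<alpha>\<alpha>)
  have F\<alpha>: "arr_map F (chain_alpha C us 0 a) \<in> Arr C"
    "Dom C (arr_map F (chain_alpha C us 0 a)) = obj_map F (Dom C (us ! 0))"
    "Cod C (arr_map F (chain_alpha C us 0 a)) = obj_map F (Dom C (us ! a))" if "a \<le> n" for a
    using that \<alpha>[of 0 a] by (simp_all add: F_simps)
  show ?thesis
  proof unfold_locales
    fix J a assume a: "J \<in> T" "a \<in> J"
    then have "a \<le> n" using T by auto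
    then show "Dom C (us ! a) \<in> Obj C"
      using us by (simp add: simplices_twisted_nerve_iff Dom_in)
    show "chain_alpha C us a a = Id C (Dom C (us ! a))"
      by (simp add: chain_alpha_def)
    fix b assume b: "b \<in> J" "a \<le> b"
    then have "b \<le> n" using a T by auto
    with \<open>a \<le> b\<close> \<open>a \<le> n\<close> show "chain_alpha C us a b \<in> Arr C"
      "Dom C (chain_alpha C us a b) = Dom C (us ! a)"
      "Cod C (chain_alpha C us a b) = Dom C (us ! b)"
      "chain_beta C F us a b \<in> Arr C"
      "Dom C (chain_beta C F us a b) = Dom C (us ! b)"
      "Cod C (chain_beta C F us a b) = obj_map F (Dom C (us ! a))"
      by (simp_all add: \<alpha> \<beta>_eq comp_simps \<gamma> F\<alpha>)
    fix c assume c: "c \<in> J" "b \<le> c"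
    then have "c \<le> n" using a T by auto
    then show "Comp C (chain_alpha C us b c) (chain_alpha C us a b) = chain_alpha C us a c"
      using b c by (simp add: \<alpha>\<alpha>)
    show "Comp C (chain_beta C F us a c) (chain_alpha C us b c) = chain_beta C F us a b"
      using b c \<open>a \<le> n\<close> \<open>c \<le> n\<close>
      by (simp add: \<beta>_eq Comp_assoc[symmetric] \<alpha> \<gamma> F\<alpha> \<gamma>\<alpha>)
    have "arr_map F (chain_alpha C us 0 b)
      = Comp C (arr_map F (chain_alpha C us a b)) (arr_map F (chain_alpha C us 0 a))"
      using arr_map_Comp[of "chain_alpha C us 0 a" "chain_alpha C us a b"] \<alpha>\<alpha>[of 0 a b]
        \<alpha> \<open>a \<le> b\<close> \<open>b \<le> n\<close> \<open>a \<le> n\<close> by simp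
    then show "Comp C (arr_map F (chain_alpha C us a b)) (chain_beta C F us a c) = chain_beta C F us b c"
      using \<open>a \<le> b\<close> \<open>b \<le> n\<close> \<open>a \<le> n\<close> \<open>c \<le> n\<close>
      by (simp add: \<beta>_eq Comp_assoc \<alpha> \<gamma> F\<alpha> F_simps)
  qed
qed

lemma chain_alpha_side:
  assumes "us \<in> simplices (twisted_nerve C F) n" "i < n"
  shows "chain_alpha C us i (Suc i) = us ! i"
  using assms Comp_Id_right[of "us ! i"]
  by (simp add: chain_alpha_def simplices_twisted_nerve_iff)

lemma chain_beta_base:
  assumes us: "us \<in> simplices (twisted_nerve C F) n"
  shows "chain_beta C F us 0 n = us ! n"
proof -
  have len: "length us = Suc n" using us by (simp add: simplices_twisted_nerve_iff)
  then have "last us = us ! n" using last_conv_nth[of us] by fastforce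
  moreover have "us ! n \<in> Arr C" "us ! 0 \<in> Arr C"
    "Cod C (us ! n) = obj_map F (Dom C (us ! 0))"
    using us by (auto simp: simplices_twisted_nerve_iff)
  ultimately show ?thesis
    using len Comp_Id_right[of "us ! n"] Comp_Id_left[of "us ! n"]
    by (simp add: chain_beta_def chain_alpha_def arr_map_Id Dom_in)
qed

lemma chain_of_chain:
  assumes us: "us \<in> simplices (twisted_nerve C F) n"
  shows "chain_of (chain_alpha C us) (chain_beta C F us) [0..<Suc n] = us"
proof (rule nth_equalityI)
  have "length us = Suc n" using us by (simp add: simplices_twisted_nerve_iff)
  then show "length (chain_of (chain_alpha C us) (chain_beta C F us) [0..<Suc n]) = length us"
    by (simp add: chain_of_def)
  fix l assume "l < length (chain_of (chain_alpha C us) (chain_beta C F us) [0..<Suc n])"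
  then have "l \<le> n" by (simp add: chain_of_def)
  then show "chain_of (chain_alpha C us) (chain_beta C F us) [0..<Suc n] ! l = us ! l"
    using chain_alpha_side[OF us, of l] chain_beta_base[OF us]
    by (auto simp: nth_chain_of[of _ n] nth_append simp del: upt_Suc)
qed

lemma hom_of_ident:
  assumes "us \<in> simplices (twisted_nerve C F) n"
  shows "hom_of {{..n}} (chain_alpha C us) (chain_beta C F us) n [0..<Suc n] = us"
  using chain_of_chain[OF assms] identity_simplex_in by (simp add: hom_of_def del: upt_Suc)

text \<open>Every chain is the image of the tautological simplex $[0, \dots, n]$ of $\Delta^n$, whose
  simplicial identities it inherits.\<close>

lemma simplicial_set_twisted_nerve: "simplicial_set (twisted_nerve C F)"
proof (rule simplicial_set_if_covered)
  fix us n assume us: "us \<in> simplices (twisted_nerve C F) n"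
  then interpret cocycle C F "{{..n}}" "\<lambda>a. Dom C (us ! a)" "chain_alpha C us" "chain_beta C F us"
    by (rule cocycle_chain) simp
  show "\<exists>(X :: nat list sset) g \<sigma>. simplicial_set X \<and> g \<in> sset_hom X (twisted_nerve C F) \<and>
    \<sigma> \<in> simplices X n \<and> us = g n \<sigma>"
    using simplicial_set_simplex_union hom_of_in identity_simplex_in hom_of_ident[OF us, symmetric] by blast
qed

text \<open>All sides of the polygon are edges of T, so a chain can be read back from its map.
  Conversely, the sides of given edge data form a chain, whose extension agrees with that data by
  \<open>cocycle_unique\<close>.\<close>

lemma bij_betw_hom_of_chain:
  assumes fill: "fillable n T" and "0 < n"
  shows "bij_betw (\<lambda>us. hom_of T (chain_alpha C us) (chain_beta C F us))
    (simplices (twisted_nerve C F) n) (sset_hom (simplex_union T) (twisted_nerve C F))"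
proof (rule bij_betw_imageI)
  have T: "J \<subseteq> {..n}" if "J \<in> T" for J
    using fillableD(1)[OF fill that] by auto
  obtain J\<^sub>0 where J\<^sub>0: "J\<^sub>0 \<in> T" "0 \<in> J\<^sub>0" "n \<in> J\<^sub>0"
    using fillableD(3)[OF fill] by blast
  show "inj_on (\<lambda>us. hom_of T (chain_alpha C us) (chain_beta C F us)) (simplices (twisted_nerve C F) n)"
  proof (rule inj_onI)
    fix us vs
    assume us: "us \<in> simplices (twisted_nerve C F) n" and vs: "vs \<in> simplices (twisted_nerve C F) n"
      and eq: "hom_of T (chain_alpha C us) (chain_beta C F us)
        = hom_of T (chain_alpha C vs) (chain_beta C F vs)"
    have "us ! i = vs ! i" if "i < n" for i
    proof -
      obtain J where J: "J \<in> T" "i \<in> J" "Suc i \<in> J"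
        using fillableD(2)[OF fill \<open>i < n\<close>] by blast
      show ?thesis
        using arg_cong[OF eq, of "\<lambda>g. g (Suc 0) [i, Suc i]"] chain_alpha_side[OF us that]
          chain_alpha_side[OF vs that] by (simp add: hom_of_edge[OF J])
    qed
    moreover have "us ! n = vs ! n"
      using arg_cong[OF eq, of "\<lambda>g. g (Suc 0) [0, n]"] chain_beta_base[OF us]
        chain_beta_base[OF vs] by (simp add: hom_of_edge[OF J\<^sub>0])
    ultimately show "us = vs"
      using us vs by (intro nth_equalityI) (auto simp: simplices_twisted_nerve_iff less_Suc_eq)
  qed
  show "(\<lambda>us. hom_of T (chain_alpha C us) (chain_beta C F us)) ` simplices (twisted_nerve C F) n
    = sset_hom (simplex_union T) (twisted_nerve C F)"
  proof (intro subset_antisym image_subsetI subsetI)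
    fix us assume "us \<in> simplices (twisted_nerve C F) n"
    then show "hom_of T (chain_alpha C us) (chain_beta C F us)
      \<in> sset_hom (simplex_union T) (twisted_nerve C F)"
      by (rule cocycle.hom_of_in[OF cocycle_chain]) (rule T)
  next
    fix g assume "g \<in> sset_hom (simplex_union T) (twisted_nerve C F)"
    then obtain x \<alpha> \<beta> where coc: "cocycle C F T x \<alpha> \<beta>" and g: "g = hom_of T \<alpha> \<beta>"
      by (rule cocycle_of_hom)
    interpret c: cocycle C F T x \<alpha> \<beta> by (fact coc)
    define us where "us = chain_of \<alpha> \<beta> [0..<Suc n]"
    have len: "length us = Suc n" by (simp add: us_def chain_of_def)
    have nth: "us ! i = \<alpha> i (Suc i)" if "i < n" for i
      using that unfolding us_def by (subst nth_chain_of[of _ n]) (auto simp del: upt_Suc)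
    have nth_n: "us ! n = \<beta> 0 n"
      unfolding us_def by (subst nth_chain_of[of _ n]) (auto simp del: upt_Suc)
    have "us ! i \<in> Arr C \<and> Dom C (us ! i) = x i \<and> Cod C (us ! i) = x (Suc i)" if i: "i < n" for i
    proof -
      obtain J where J: "J \<in> T" "i \<in> J" "Suc i \<in> J"
        using fillableD(2)[OF fill \<open>i < n\<close>] by blast
      show ?thesis
        using c.alpha_in[OF J] c.Dom_alpha[OF J] c.Cod_alpha[OF J] nth[OF i] by simp
    qed
    moreover have "us ! n \<in> Arr C \<and> Dom C (us ! n) = x n \<and> Cod C (us ! n) = obj_map F (x 0)"
      using c.beta_in[OF J\<^sub>0] c.Dom_beta[OF J\<^sub>0] c.Cod_beta[OF J\<^sub>0] nth_n by simp
    ultimately have us: "us \<in> simplices (twisted_nerve C F) n"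
      using len \<open>0 < n\<close> unfolding simplices_twisted_nerve_iff
      by (metis Suc_lessI le_neq_implies_less)
    have "hom_of T (chain_alpha C us) (chain_beta C F us) = hom_of T \<alpha> \<beta>"
    proof (rule hom_of_cong)
      fix J a b assume "J \<in> T" "a \<in> J" "b \<in> J" "a \<le> b"
      then show "chain_alpha C us a b = \<alpha> a b \<and> chain_beta C F us a b = \<beta> a b"
        by (rule cocycle_unique[OF fill \<open>0 < n\<close> cocycle_chain[OF us T] coc, rotated -4])
           (auto simp: chain_alpha_side[OF us] chain_beta_base[OF us] nth nth_n)
    qed
    then show "g \<in> (\<lambda>us. hom_of T (chain_alpha C us) (chain_beta C F us))
      ` simplices (twisted_nerve C F) n"
      using g by (intro image_eqI[OF _ us]) simp
  qed
qed

text \<open>The bijection for T = {[n]} puts every competing map in the form given by some chain,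
  and evaluation at [0..n] returns that chain.\<close>

lemma classifying_map_twisted_nerve:
  assumes us: "us \<in> simplices (twisted_nerve C F) n" and "0 < n"
  shows "classifying_map (twisted_nerve C F) n us
    = hom_of {{..n}} (chain_alpha C us) (chain_beta C F us)"
  unfolding classifying_map_def std_simplex_def
proof (rule the_equality)
  note bij = bij_betw_hom_of_chain[OF fillable_full \<open>0 < n\<close>]
  show "hom_of {{..n}} (chain_alpha C us) (chain_beta C F us)
      \<in> sset_hom (simplex_union {{..n}}) (twisted_nerve C F) \<and>
    hom_of {{..n}} (chain_alpha C us) (chain_beta C F us) n [0..<Suc n] = us"
    using hom_of_ident[OF us] bij_betwE[OF bij] us by blast
  fix g assume g: "g \<in> sset_hom (simplex_union {{..n}}) (twisted_nerve C F) \<and> g n [0..<Suc n] = us"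
  then obtain vs where "vs \<in> simplices (twisted_nerve C F) n"
    "g = hom_of {{..n}} (chain_alpha C vs) (chain_beta C F vs)"
    using bij_betw_imp_surj_on[OF bij] by blast
  with g hom_of_ident show "g = hom_of {{..n}} (chain_alpha C us) (chain_beta C F us)" by metis
qed

end

text \<open>Both maps are given by the same \<open>chain_of\<close> and differ only in the domain to
  which it is cut down.\<close>

lemma restrict_hom_hom_of:
  assumes "\<And>J. J \<in> T \<Longrightarrow> J \<subseteq> {..n}"
  shows "restrict_hom (simplex_union T) (hom_of {{..n}} \<alpha> \<beta>) = hom_of T \<alpha> \<beta>"
proof
  fix k
  have "simplices (simplex_union T) k \<subseteq> simplices (simplex_union {{..n}}) k"
    using assms by (fastforce simp: simplices_simplex_union_iff)
  then show "restrict_hom (simplex_union T) (hom_of {{..n}} \<alpha> \<beta>) k = hom_of T \<alpha> \<beta> k"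
    by (simp add: restrict_hom_def hom_of_def restrict_restrict Int_absorb1)
qed

theorem theorem3p2p3:
  fixes C :: "('o, 'm) cat" and F :: "('o, 'm) endo"
  assumes "category C" and "endofunctor C F"
  shows "two_segal (twisted_nerve C F)"
proof -
  interpret endofunctor C F by fact
  show ?thesis
    unfolding two_segal_def
  proof (intro conjI allI impI, goal_cases)
    case 1
    show ?case by (rule simplicial_set_twisted_nerve)
  next
    case (2 n p T)
    then have fill: "fillable n T" and "0 < n"
      using fillable_polygon_triangulation by auto
    \<comment> \<open>On chains, the restriction map of the 2-Segal condition is thus the map
      already shown to be bijective.\<close>
    have "restrict_hom (simplex_union T) (classifying_map (twisted_nerve C F) n us)
      = hom_of T (chain_alpha C us) (chain_beta C F us)"
      if "us \<in> simplices (twisted_nerve C F) n" for us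
      using fillableD(1)[OF fill] classifying_map_twisted_nerve[OF that \<open>0 < n\<close>]
      by (simp add: restrict_hom_hom_of subset_iff)
    then show ?case
      using bij_betw_hom_of_chain[OF fill \<open>0 < n\<close>] by (simp cong: bij_betw_cong)
  qed
qed

end
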